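(* Let $G_1, G_2$ be two finite groups and, for $j=1,2$, let $Z_j$ be a central subgroup of $G_j$ such that the sequence $$1 \to \mathrm{Hom}(Z_j,\mathbb C^\times) \xrightarrow{\mathrm{tra}_j} H^2(G_j/Z_j,\mathbb C^\times) \xrightarrow{\inf_j} H^2(G_j,\mathbb C^\times) \to 1$$ is exact. Here $\mathrm{tra}_j$ is the transgression map associated with the central extension $1\to Z_j\to G_j\to G_j/Z_j\to 1$ and $\inf_j$ is inflation. Suppose there are an isomorphism $\bar i:\mathrm{Hom}(Z_1,\mathbb C^\times)\to\mathrm{Hom}(Z_2,\mathbb C^\times)$ and an isomorphism $\bar\phi: H^2(G_1/Z_1,\mathbb C^\times)\to H^2(G_2/Z_2,\mathbb C^\times)$ such that $G_1/Z_1\sim_{\mathbb C} G_2/Z_2$ via the map $\bar\phi$ and $$\bar\phi\circ \mathrm{tra}_1=\mathrm{tra}_2\circ\bar i .$$ Then $G_1\sim_{\mathbb C}G_2$.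
   Context: For a finite group $G$, $Z^2(G,\mathbb C^\times)$ is the group of $2$-cocycles with trivial $G$-action on $\mathbb C^\times$, and $H^2(G,\mathbb C^\times)$ is the second cohomology group. For $\alpha\in Z^2(G,\mathbb C^\times)$, the twisted group algebra $\mathbb C^\alpha G$ is the $\mathbb C$-vector space with basis $\{\bar g: g\in G\}$ and multiplication determined by $\bar g\,\bar h=\alpha(g,h)\overline{gh}$; up to isomorphism it depends only on the class $[\alpha]$. For finite groups $G,H$ we say $G\sim_{\mathbb C}H$ via the map $\phi$ if $\phi:H^2(G,\mathbb C^\times)\to H^2(H,\mathbb C^\times)$ is a group isomorphism such that $\mathbb C^\alpha G\cong\mathbb C^{\phi(\alpha)}H$ (as $\mathbb C$-algebras) for every $[\alpha]\in H^2(G,\mathbb C^\times)$, where $\phi(\alpha)$ denotes a cocycle representing $\phi([\alpha])$. We write $G\sim_{\mathbb C}H$ if such a $\phi$ exists. Inflation: for $Z\trianglelefteq G$, $\inf:H^2(G/Z,\mathbb C^\times)\to H^2(G,\mathbb C^\times)$ sends $[\alpha]$ to $[\alpha']$ with $\alpha'(x,y)=\alpha(xZ,yZ)$. Transgression: for a central extension $1\to Z\to G\to G/Z\to 1$ with a section $\mu: G/Z\to G$, $\mathrm{tra}:\mathrm{Hom}(Z,\mathbb C^\times)\to H^2(G/Z,\mathbb C^\times)$ sends $\chi$ to the class of $(x,y)\mapsto\chi(\mu(x)\mu(y)\mu(xy)^{-1})$. *)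

theory Defs
  imports Complex_Main "HOL-Algebra.QuotRing" "HOL-Algebra.Module" "HOL-Algebra.Product_Groups"
    "HOL-Algebra.Exact_Sequence"
begin

definition complex_units :: "complex monoid" where
  "complex_units = \<lparr>carrier = - {0}, monoid.mult = (*), one = 1\<rparr>"

text \<open>The group of homomorphisms from \<open>A\<close> to the multiplicative group of complex numbers.
  Here and for cochains below, functions are normalised to be \<^const>\<open>undefined\<close> off their
  mathematical domain, so that equality in HOL is equality on that domain.\<close>

definition character_group :: "('a, 'm) monoid_scheme \<Rightarrow> ('a \<Rightarrow> complex) monoid" where
  "character_group A =
     (product_group (carrier A) (\<lambda>_. complex_units))
       \<lparr>carrier := hom A complex_units \<inter> extensional (carrier A)\<rparr>"


subsection \<open>Second cohomology with trivial action\<close>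

definition cochains2 :: "('a, 'm) monoid_scheme \<Rightarrow> ('a \<times> 'a \<Rightarrow> complex) monoid" where
  "cochains2 G = product_group (carrier G \<times> carrier G) (\<lambda>_. complex_units)"

definition cocycles2 :: "('a, 'm) monoid_scheme \<Rightarrow> ('a \<times> 'a \<Rightarrow> complex) monoid" where
  "cocycles2 G = (cochains2 G)
     \<lparr>carrier := {\<alpha> \<in> carrier (cochains2 G).
        \<forall>x\<in>carrier G. \<forall>y\<in>carrier G. \<forall>z\<in>carrier G.
          \<alpha> (x, y) * \<alpha> (x \<otimes>\<^bsub>G\<^esub> y, z) = \<alpha> (x, y \<otimes>\<^bsub>G\<^esub> z) * \<alpha> (y, z)}\<rparr>"

definition coboundary2 :: "('a, 'm) monoid_scheme \<Rightarrow> ('a \<Rightarrow> complex) \<Rightarrow> 'a \<times> 'a \<Rightarrow> complex" where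
  "coboundary2 G f = (\<lambda>(x, y)\<in>carrier G \<times> carrier G. f x * f y / f (x \<otimes>\<^bsub>G\<^esub> y))"

definition coboundaries2 :: "('a, 'm) monoid_scheme \<Rightarrow> ('a \<times> 'a \<Rightarrow> complex) set" where
  "coboundaries2 G = coboundary2 G ` (carrier G \<rightarrow> carrier complex_units)"

definition H2 :: "('a, 'm) monoid_scheme \<Rightarrow> ('a \<times> 'a \<Rightarrow> complex) set monoid" where
  "H2 G = cocycles2 G Mod coboundaries2 G"

definition cohomology_class ::
  "('a, 'm) monoid_scheme \<Rightarrow> ('a \<times> 'a \<Rightarrow> complex) \<Rightarrow> ('a \<times> 'a \<Rightarrow> complex) set" where
  "cohomology_class G \<alpha> = coboundaries2 G #>\<^bsub>cocycles2 G\<^esub> \<alpha>"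


subsection \<open>Twisted group algebras\<close>

text \<open>An element of the twisted group algebra is represented by its coefficient function with
  respect to the basis indexed by \<open>carrier G\<close>. Cocycles need not be normalised, so the unit element is
  \<open>inverse (\<alpha> (\<one>, \<one>))\<close> times the basis element at \<open>\<one>\<close>. The sum defining the product is
  the intended one only for finite \<open>G\<close>.\<close>

definition twisted_group_algebra ::
  "('a, 'm) monoid_scheme \<Rightarrow> ('a \<times> 'a \<Rightarrow> complex) \<Rightarrow> (complex, 'a \<Rightarrow> complex) module" where
  "twisted_group_algebra G \<alpha> =
     \<lparr>carrier = carrier G \<rightarrow>\<^sub>E UNIV,
      monoid.mult = (\<lambda>f g. \<lambda>x\<in>carrier G.
        \<Sum>(y, z) \<in> {(y, z) \<in> carrier G \<times> carrier G. y \<otimes>\<^bsub>G\<^esub> z = x}. f y * g z * \<alpha> (y, z)),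
      one = (\<lambda>x\<in>carrier G. if x = \<one>\<^bsub>G\<^esub> then inverse (\<alpha> (\<one>\<^bsub>G\<^esub>, \<one>\<^bsub>G\<^esub>)) else 0),
      ring.zero = (\<lambda>x\<in>carrier G. 0),
      add = (\<lambda>f g. \<lambda>x\<in>carrier G. f x + g x),
      smult = (\<lambda>c f. \<lambda>x\<in>carrier G. c * f x)\<rparr>"

definition algebra_iso ::
  "(complex, 'a) module \<Rightarrow> (complex, 'b) module \<Rightarrow> ('a \<Rightarrow> 'b) set" where
  "algebra_iso A B =
     {h \<in> ring_iso A B. \<forall>c. \<forall>x\<in>carrier A. h (c \<odot>\<^bsub>A\<^esub> x) = c \<odot>\<^bsub>B\<^esub> h x}"

text \<open>The elements of a cohomology class are exactly its representing cocycles.\<close>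

definition twisted_equiv_via ::
  "(('a \<times> 'a \<Rightarrow> complex) set \<Rightarrow> ('b \<times> 'b \<Rightarrow> complex) set)
     \<Rightarrow> ('a, 'm) monoid_scheme \<Rightarrow> ('b, 'n) monoid_scheme \<Rightarrow> bool" where
  "twisted_equiv_via \<phi> G H \<longleftrightarrow>
     \<phi> \<in> iso (H2 G) (H2 H) \<and>
     (\<forall>c\<in>carrier (H2 G). \<forall>\<alpha>\<in>c. \<forall>\<beta>\<in>\<phi> c.
        algebra_iso (twisted_group_algebra G \<alpha>) (twisted_group_algebra H \<beta>) \<noteq> {})"

definition twisted_equiv :: "('a, 'm) monoid_scheme \<Rightarrow> ('b, 'n) monoid_scheme \<Rightarrow> bool" where
  "twisted_equiv G H \<longleftrightarrow> (\<exists>\<phi>. twisted_equiv_via \<phi> G H)"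


subsection \<open>Inflation and transgression\<close>

definition central_subgroup :: "'a set \<Rightarrow> ('a, 'm) monoid_scheme \<Rightarrow> bool" where
  "central_subgroup Z G \<longleftrightarrow>
     subgroup Z G \<and> (\<forall>z\<in>Z. \<forall>g\<in>carrier G. z \<otimes>\<^bsub>G\<^esub> g = g \<otimes>\<^bsub>G\<^esub> z)"

definition inflate_cocycle ::
  "('a, 'm) monoid_scheme \<Rightarrow> 'a set \<Rightarrow> ('a set \<times> 'a set \<Rightarrow> complex) \<Rightarrow> 'a \<times> 'a \<Rightarrow> complex" where
  "inflate_cocycle G Z \<alpha> =
     (\<lambda>(x, y)\<in>carrier G \<times> carrier G. \<alpha> (Z #>\<^bsub>G\<^esub> x, Z #>\<^bsub>G\<^esub> y))"

text \<open>\<^const>\<open>the_elem\<close> is applied to a singleton: inflations of cohomologous cocycles are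
  cohomologous.\<close>

definition inflation ::
  "('a, 'm) monoid_scheme \<Rightarrow> 'a set
     \<Rightarrow> ('a set \<times> 'a set \<Rightarrow> complex) set \<Rightarrow> ('a \<times> 'a \<Rightarrow> complex) set" where
  "inflation G Z c = the_elem ((\<lambda>\<alpha>. cohomology_class G (inflate_cocycle G Z \<alpha>)) ` c)"

definition coset_section :: "('a, 'm) monoid_scheme \<Rightarrow> 'a set \<Rightarrow> ('a set \<Rightarrow> 'a) \<Rightarrow> bool" where
  "coset_section G Z \<sigma> \<longleftrightarrow> (\<forall>U\<in>carrier (G Mod Z). \<sigma> U \<in> U)"

text \<open>The cohomology class below does not depend on the section \<open>\<sigma>\<close>, which need not be
  normalised.\<close>

definition transgression ::
  "('a, 'm) monoid_scheme \<Rightarrow> 'a set \<Rightarrow> ('a set \<Rightarrow> 'a)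
     \<Rightarrow> ('a \<Rightarrow> complex) \<Rightarrow> ('a set \<times> 'a set \<Rightarrow> complex) set" where
  "transgression G Z \<sigma> \<chi> = cohomology_class (G Mod Z)
     (\<lambda>(U, V)\<in>carrier (G Mod Z) \<times> carrier (G Mod Z).
        \<chi> (\<sigma> U \<otimes>\<^bsub>G\<^esub> \<sigma> V \<otimes>\<^bsub>G\<^esub> inv\<^bsub>G\<^esub> (\<sigma> (U \<otimes>\<^bsub>G Mod Z\<^esub> V))))"

text \<open>Exactness of \<open>1 \<rightarrow> A \<rightarrow> B \<rightarrow> C \<rightarrow> 1\<close>. The predicate \<^const>\<open>short_exact_sequence\<close> of the
  library needs \<open>A\<close>, \<open>B\<close>, \<open>C\<close> to have the same element type, which fails here.\<close>

definition short_exact ::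
  "('a, 'm) monoid_scheme \<Rightarrow> ('b, 'n) monoid_scheme \<Rightarrow> ('c, 'k) monoid_scheme
     \<Rightarrow> ('a \<Rightarrow> 'b) \<Rightarrow> ('b \<Rightarrow> 'c) \<Rightarrow> bool" where
  "short_exact A B C f g \<longleftrightarrow>
     group A \<and> group B \<and> group C \<and> f \<in> mon A B \<and> g \<in> epi B C \<and>
     kernel B C g = f ` carrier A"

end

theory Submission
  imports Defs "HOL-Algebra.Multiplicative_Group"
begin

text \<open>
  For a cocycle \<open>\<alpha>\<close> of \<open>G/Z\<close>, the algebra twisted by the inflation of \<open>\<alpha>\<close> is the product over the
  characters \<open>\<chi>\<close> of \<open>Z\<close> of the algebras of \<open>G/Z\<close> twisted by \<open>\<alpha> \<cdot> tra \<chi>\<close>. Writing \<open>x = z \<sigma>(Zx)\<close> with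
  \<open>z \<in> Z\<close>, the component at \<open>\<chi>\<close> of the isomorphism sends the basis element at \<open>x\<close> to \<open>\<chi>(z)\<close> times the
  basis element at \<open>Zx\<close>, and orthogonality of the characters of \<open>Z\<close> inverts it.
  Since \<open>\<phi>\<close> matches the images of the transgressions, which are the kernels of the surjective
  inflations, it descends to an isomorphism \<open>H2 G1 \<rightarrow> H2 G2\<close>. For \<open>\<alpha>\<close> on \<open>G1/Z1\<close> and \<open>\<beta>\<close> in \<open>\<phi>[\<alpha>]\<close>,
  the factors \<open>\<alpha> \<cdot> tra1 \<chi>\<close> and \<open>\<beta> \<cdot> tra2 (i \<chi>)\<close> have isomorphic algebras by hypothesis, hence so
  have the two products.
\<close>

subsection \<open>Characters of finite abelian groups\<close>

lemma complex_units_simps [simp]: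
  "carrier complex_units = - {0}" "x \<otimes>\<^bsub>complex_units\<^esub> y = x * y" "\<one>\<^bsub>complex_units\<^esub> = 1"
  by (simp_all add: complex_units_def)

text \<open>For 0 < k < N the map \<open>w ^ k\<close> is a non-trivial character of the group of
  N-th roots of unity. Multiplying the summation variable by a root \<open>v\<close> with
  \<open>v ^ k\<close> different from 1 permutes the roots and scales the sum by
  \<open>v ^ k\<close>, so the sum vanishes.\<close>

lemma sum_powers_roots_unity:
  assumes "k < N"
  shows "(\<Sum>w | w ^ N = (1::complex). w ^ k) = (if k = 0 then of_nat N else 0)"
proof (cases "k = 0")
  case True
  with assms show ?thesis by (simp add: card_roots_unity_eq)
next
  case False
  have fin: "finite {w::complex. w ^ N = 1}"
    using assms by (intro finite_roots_unity) simp
  \<comment> \<open>There are only k < N solutions of \<open>w ^ k = 1\<close>, so some N-th root of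
    unity is not among them.\<close>
  have "card {w::complex. w ^ k = 1} < card {w::complex. w ^ N = 1}"
    using assms False by (simp add: card_roots_unity_eq)
  then obtain v :: complex where v: "v ^ N = 1" "v ^ k \<noteq> 1"
    using card_mono[of "{w::complex. w ^ k = 1}" "{w. w ^ N = 1}"] False finite_roots_unity[of k]
    by (metis (mono_tags, lifting) One_nat_def Suc_leI bot_nat_0.not_eq_extremum linorder_not_less mem_Collect_eq subsetI)
  then have "v \<noteq> 0" using assms by (metis not_less_zero power_0_left zero_neq_one)
  have "(\<Sum>w | w ^ N = 1. w ^ k) = (\<Sum>w | w ^ N = 1. (v * w) ^ k)"
    by (rule sum.reindex_bij_witness[where i = "\<lambda>w. v * w" and j = "\<lambda>w. w / v"])
      (use v \<open>v \<noteq> 0\<close> in \<open>auto simp: power_mult_distrib power_divide\<close>)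
  also have "\<dots> = v ^ k * (\<Sum>w | w ^ N = 1. w ^ k)"
    by (simp add: power_mult_distrib sum_distrib_left)
  finally show ?thesis using v False by simp
qed

section \<open>Projections to the eigenspaces of translations\<close>

text \<open>For \<open>w ^ order A = 1\<close> this is, up to the factor 1/|A|, the projection to
  the eigenspace with eigenvalue \<open>inverse w\<close> of the translation by \<open>g\<close>.
  The range is the order of the group and not that of \<open>g\<close>, so that the same roots of
  unity serve every \<open>g\<close>.\<close>

definition twisted_orbit_sum ::
  "('a, 'm) monoid_scheme \<Rightarrow> complex \<Rightarrow> 'a \<Rightarrow> ('a \<Rightarrow> complex) \<Rightarrow> 'a \<Rightarrow> complex" where
  "twisted_orbit_sum A w g f x = (\<Sum>k<order A. w ^ k * f (g [^]\<^bsub>A\<^esub> k \<otimes>\<^bsub>A\<^esub> x))"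

text \<open>Translation shifts the index k by one; the two boundary terms agree because both
  \<open>w\<close> and \<open>g\<close> have trivial power at \<open>order G\<close>.\<close>

lemma (in group) twisted_orbit_sum_shift:
  assumes "w ^ order G = 1" "g \<in> carrier G" "x \<in> carrier G"
  shows "w * twisted_orbit_sum G w g f (g \<otimes> x) = twisted_orbit_sum G w g f x"
proof -
  define h where "h k = w ^ k * f (g [^] k \<otimes> x)" for k :: nat
  have "w * twisted_orbit_sum G w g f (g \<otimes> x) = (\<Sum>k<order G. h (Suc k))"
    using assms by (simp add: twisted_orbit_sum_def h_def sum_distrib_left m_assoc mult_ac)
  also have "\<dots> = (\<Sum>k<order G. h k) + h (order G) - h 0"
    using sum.lessThan_Suc_shift[of h "order G"] by simp
  also have "h (order G) = h 0"
    using assms by (simp add: h_def pow_order_eq_1)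
  finally show ?thesis by (simp add: twisted_orbit_sum_def h_def)
qed

text \<open>Summing over w first, \<open>sum_powers_roots_unity\<close> kills every k > 0: the
  eigenprojections add up to the identity, scaled by |G|.\<close>

lemma (in group) sum_twisted_orbit_sum:
  assumes "finite (carrier G)" "g \<in> carrier G" "x \<in> carrier G"
  shows "(\<Sum>w | w ^ order G = 1. twisted_orbit_sum G w g f x) = of_nat (order G) * f x"
proof -
  have "(\<Sum>w | w ^ order G = 1. twisted_orbit_sum G w g f x) =
      (\<Sum>k<order G. (\<Sum>w | w ^ order G = 1. w ^ k) * f (g [^] k \<otimes> x))"
    unfolding twisted_orbit_sum_def by (subst sum.swap) (simp add: sum_distrib_right)
  also have "\<dots> = (\<Sum>k<order G. if k = 0 then of_nat (order G) * f x else 0)"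
    by (intro sum.cong refl) (use assms in \<open>auto simp: sum_powers_roots_unity\<close>)
  also have "\<dots> = of_nat (order G) * f x"
    using assms order_gt_0_iff_finite by simp
  finally show ?thesis .
qed

text \<open>Up to a non-zero factor \<open>f x\<close> is the sum of its eigencomponents, so these
  cannot all vanish at \<open>x\<close>.\<close>

lemma (in group) exists_twisted_orbit_sum_neq_0:
  assumes "finite (carrier G)" "g \<in> carrier G" "x \<in> carrier G" "f x \<noteq> 0"
  obtains w where "w ^ order G = 1" "twisted_orbit_sum G w g f x \<noteq> 0"
proof -
  have "(\<Sum>w | w ^ order G = 1. twisted_orbit_sum G w g f x) \<noteq> 0"
    using assms order_gt_0_iff_finite by (simp add: sum_twisted_orbit_sum)
  then show thesis using that by (metis (mono_tags, lifting) mem_Collect_eq sum.neutral)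
qed

text \<open>The character is read off a common eigenvector of all translations. One starts with
  the eigenvector of the translation by \<open>a\<close> obtained from
  \<open>x \<mapsto> [x = 1] - [a x = 1]\<close>, whose invariant projection vanishes, and projects
  successively to eigenspaces of the other translations.\<close>

lemma (in comm_group) exists_character_neq_1:
  assumes fin: "finite (carrier G)" and a: "a \<in> carrier G" "a \<noteq> \<one>"
  shows "\<exists>\<chi>\<in>hom G complex_units. \<chi> a \<noteq> 1"
proof -
  define E where "E f g c \<longleftrightarrow> (\<forall>x\<in>carrier G. f (g \<otimes> x) = c * f x)"
    for f :: "'a \<Rightarrow> complex" and g c
  have nz: "w \<noteq> 0" if "w ^ order G = 1" for w :: complex
    using that fin order_gt_0_iff_finite by (metis neq0_conv power_0_left zero_neq_one)
  have E_new: "E (twisted_orbit_sum G w g f) g (inverse w)"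
    if "w ^ order G = 1" "g \<in> carrier G" for w g f
    using twisted_orbit_sum_shift[OF that] nz[OF that(1)] by (auto simp: E_def field_simps)
  \<comment> \<open>Translations commute, so projecting for \<open>g\<close> keeps the eigenvalue of
    every translation treated earlier.\<close>
  have E_old: "E (twisted_orbit_sum G w g f) h c"
    if "E f h c" "g \<in> carrier G" "h \<in> carrier G" for w g f h c
    using that by (auto simp: E_def twisted_orbit_sum_def m_lcomm sum_distrib_left mult_ac)
  \<comment> \<open>The last conjunct carries the eigenvalue at \<open>a\<close> through the
    induction; it becomes the value of the character there.\<close>
  have ex: "\<exists>f. (\<exists>x\<in>carrier G. f x \<noteq> 0) \<and> (\<forall>s\<in>S. \<exists>c. E f s c) \<and> (\<exists>c. c \<noteq> 1 \<and> E f a c)"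
    if "S \<subseteq> carrier G" for S
    using finite_subset[OF that fin] that
  proof (induction S rule: finite_induct)
    case empty
    define f :: "'a \<Rightarrow> complex"
      where "f x = (if x = \<one> then 1 else 0) - (if a \<otimes> x = \<one> then 1 else 0)" for x
    have f1: "f \<one> \<noteq> 0" using a by (simp add: f_def)
    \<comment> \<open>For w = 1 the orbit sum telescopes to \<open>h 0 - h (order G)\<close>, which
      is zero since the power of \<open>a\<close> at \<open>order G\<close> is trivial. Hence a root
      with non-zero component differs from 1, and so does its eigenvalue.\<close>
    have zero: "twisted_orbit_sum G 1 a f x = 0" if x: "x \<in> carrier G" for x
    proof -
      define h :: "nat \<Rightarrow> complex" where "h k = (if a [^] k \<otimes> x = \<one> then 1 else 0)" for k
      have "a \<otimes> (a [^] k \<otimes> x) = a [^] Suc k \<otimes> x" for k :: nat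
        using a x by (simp add: m_lcomm m_assoc)
      then have "twisted_orbit_sum G 1 a f x = (\<Sum>k<order G. h k - h (Suc k))"
        by (simp add: twisted_orbit_sum_def f_def h_def del: nat_pow_Suc)
      also have "\<dots> = h 0 - h (order G)" by (rule sum_lessThan_telescope')
      also have "\<dots> = 0" using a x by (simp add: h_def pow_order_eq_1)
      finally show ?thesis .
    qed
    obtain w where w: "w ^ order G = 1" "twisted_orbit_sum G w a f \<one> \<noteq> 0"
      using exists_twisted_orbit_sum_neq_0[of a \<one> f] fin a f1 by auto
    have "w \<noteq> 1" using zero w(2) by auto
    then have "inverse w \<noteq> 1" by simp
    with E_new[OF w(1) a(1)] w(2) show ?case by (metis empty_iff one_closed)
  next
    case (insert g S)
    then obtain f x c where f: "x \<in> carrier G" "f x \<noteq> 0" "\<forall>s\<in>S. \<exists>c. E f s c" "c \<noteq> 1" "E f a c"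
      by auto
    obtain w where w: "w ^ order G = 1" "twisted_orbit_sum G w g f x \<noteq> 0"
      using exists_twisted_orbit_sum_neq_0[of g x f] fin insert.prems f by auto
    show ?case
      using E_new[OF w(1), of g f] E_old[of f _ _ g w] insert.prems w(2) f a(1)
      by (intro exI[of _ "twisted_orbit_sum G w g f"]) (auto; blast)
  qed
  obtain f x c0 where x: "x \<in> carrier G" "f x \<noteq> 0" and c0: "c0 \<noteq> 1" "E f a c0"
    and "\<forall>s\<in>carrier G. \<exists>c. E f s c"
    using ex[OF order_refl] by auto
  then obtain \<chi> where \<chi>: "\<And>s. s \<in> carrier G \<Longrightarrow> E f s (\<chi> s)" by metis
  \<comment> \<open>Successive translations multiply eigenvalues; evaluating at a point where
    \<open>f\<close> does not vanish allows cancellation.\<close>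
  have mult: "\<chi> (s \<otimes> t) = \<chi> s * \<chi> t" if "s \<in> carrier G" "t \<in> carrier G" for s t
  proof -
    have "\<chi> (s \<otimes> t) * f x = f (s \<otimes> (t \<otimes> x))"
      using \<chi>[of "s \<otimes> t"] that x by (simp add: E_def m_assoc)
    also have "\<dots> = \<chi> s * \<chi> t * f x"
      using \<chi>[of s] \<chi>[of t] that x by (simp add: E_def)
    finally show ?thesis using x by simp
  qed
  have "\<chi> \<one> = 1" using \<chi>[of \<one>] x by (auto simp: E_def)
  then have "\<chi> s \<noteq> 0" if "s \<in> carrier G" for s
    using mult[of s "inv s"] that by auto
  then have "\<chi> \<in> hom G complex_units" using mult by (auto simp: hom_def)
  moreover have "\<chi> a = c0" using \<chi>[OF a(1)] c0 x unfolding E_def by fastforce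
  ultimately show ?thesis using c0 by auto
qed

section \<open>The character group and the orthogonality relations\<close>

lemma carrier_character_group:
  "carrier (character_group A) = hom A complex_units \<inter> extensional (carrier A)"
  by (simp add: character_group_def)

lemma (in group) characterD:
  assumes "\<chi> \<in> carrier (character_group G)"
  shows "\<And>x y. \<lbrakk>x \<in> carrier G; y \<in> carrier G\<rbrakk> \<Longrightarrow> \<chi> (x \<otimes> y) = \<chi> x * \<chi> y"
    and "\<And>x. x \<in> carrier G \<Longrightarrow> \<chi> x \<noteq> 0"
    and "\<chi> \<one> = 1"
    and "\<And>x. x \<in> carrier G \<Longrightarrow> \<chi> (inv x) = inverse (\<chi> x)"
proof -
  have h: "\<chi> \<in> hom G complex_units"
    using assms by (simp add: carrier_character_group)
  then show mult: "\<And>x y. \<lbrakk>x \<in> carrier G; y \<in> carrier G\<rbrakk> \<Longrightarrow> \<chi> (x \<otimes> y) = \<chi> x * \<chi> y"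
    and nz: "\<And>x. x \<in> carrier G \<Longrightarrow> \<chi> x \<noteq> 0"
    by (auto simp: hom_def Pi_def)
  show one: "\<chi> \<one> = 1" using mult[of \<one> \<one>] nz[of \<one>] by simp
  show "\<chi> (inv x) = inverse (\<chi> x)" if "x \<in> carrier G" for x
    using mult[of x "inv x"] one that nz[OF that] by (simp add: field_simps)
qed

lemma (in group) character_mult_closed:
  assumes "\<chi> \<in> carrier (character_group G)" "\<psi> \<in> carrier (character_group G)"
  shows "(\<lambda>x\<in>carrier G. \<chi> x * \<psi> x) \<in> carrier (character_group G)"
  using characterD[OF assms(1)] characterD[OF assms(2)]
  by (auto simp: carrier_character_group hom_def)

lemma (in group) character_inverse_closed:
  assumes "\<chi> \<in> carrier (character_group G)"
  shows "(\<lambda>x\<in>carrier G. inverse (\<chi> x)) \<in> carrier (character_group G)"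
  using characterD[OF assms] by (auto simp: carrier_character_group hom_def)

text \<open>All values are roots of unity for the exponent |G|, so the characters lie in a finite
  function space.\<close>

lemma (in group) finite_character_group:
  assumes "finite (carrier G)"
  shows "finite (carrier (character_group G))"
proof -
  have pw: "\<chi> (x [^] n) = \<chi> x ^ n"
    if "\<chi> \<in> carrier (character_group G)" "x \<in> carrier G" for \<chi> x and n :: nat
    by (induction n) (use that characterD[OF that(1)] in auto)
  have "\<chi> x ^ order G = 1"
    if "\<chi> \<in> carrier (character_group G)" "x \<in> carrier G" for \<chi> x
    using pw[OF that, of "order G"] characterD(3)[OF that(1)] pow_order_eq_1[OF that(2)] by simp
  then have "carrier (character_group G) \<subseteq> (\<Pi>\<^sub>E x\<in>carrier G. {w. w ^ order G = 1})"
    by (auto simp: carrier_character_group PiE_def)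
  moreover have "finite {w::complex. w ^ order G = 1}"
    using assms order_gt_0_iff_finite by (intro finite_roots_unity) (simp add: Suc_leI)
  ultimately show ?thesis using assms by (meson finite_PiE finite_subset)
qed

text \<open>If \<open>\<chi> a\<close> is not 1, translating the summation variable by
  \<open>a\<close> multiplies the sum by \<open>\<chi> a\<close>.\<close>

lemma (in group) sum_character:
  assumes "finite (carrier G)" "\<chi> \<in> carrier (character_group G)"
  shows "(\<Sum>x\<in>carrier G. \<chi> x) = (if \<forall>x\<in>carrier G. \<chi> x = 1 then of_nat (order G) else 0)"
proof (cases "\<forall>x\<in>carrier G. \<chi> x = 1")
  case False
  then obtain a where a: "a \<in> carrier G" "\<chi> a \<noteq> 1" by auto
  have "(\<Sum>x\<in>carrier G. \<chi> x) = (\<Sum>x\<in>carrier G. \<chi> (a \<otimes> x))"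
    by (rule sum.reindex_bij_witness[where i = "\<lambda>x. a \<otimes> x" and j = "\<lambda>x. inv a \<otimes> x"])
      (use a in \<open>auto simp flip: m_assoc\<close>)
  also have "\<dots> = \<chi> a * (\<Sum>x\<in>carrier G. \<chi> x)"
    using characterD(1)[OF assms(2)] a by (simp add: sum_distrib_left)
  finally show ?thesis using a False by auto
qed (simp add: order_def)

text \<open>Dual to \<open>sum_character\<close>: multiplication by a character \<theta> with
  \<open>\<theta> a\<close> different from 1 permutes the characters and scales the sum by
  \<open>\<theta> a\<close>. Such a \<theta> is supplied by
  \<open>exists_character_neq_1\<close>.\<close>

lemma (in comm_group) sum_over_characters:
  assumes fin: "finite (carrier G)" and a: "a \<in> carrier G"
  shows "(\<Sum>\<chi>\<in>carrier (character_group G). \<chi> a) =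
    (if a = \<one> then of_nat (card (carrier (character_group G))) else 0)"
proof (cases "a = \<one>")
  case True
  then have "(\<Sum>\<chi>\<in>carrier (character_group G). \<chi> a) = (\<Sum>\<chi>\<in>carrier (character_group G). 1)"
    by (intro sum.cong refl) (simp add: characterD(3))
  with True show ?thesis by simp
next
  case False
  then obtain \<eta> where "\<eta> \<in> hom G complex_units" "\<eta> a \<noteq> 1"
    using exists_character_neq_1[OF fin a] by blast
  \<comment> \<open>Elements of the character group are \<open>undefined\<close> off the carrier,
    whereas \<eta> is only known to be a homomorphism on it.\<close>
  define \<theta> where "\<theta> = restrict \<eta> (carrier G)"
  let ?X = "carrier (character_group G)"
  have \<theta>: "\<theta> \<in> ?X" "\<theta> a \<noteq> 1"
    using a \<open>\<eta> \<in> hom G complex_units\<close> \<open>\<eta> a \<noteq> 1\<close>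
    by (auto simp: \<theta>_def carrier_character_group hom_def)
  note D = characterD[OF \<theta>(1)]
  \<comment> \<open>The inverse of multiplication by \<theta> is written with a nested restriction
    because \<open>character_mult_closed\<close> and \<open>character_inverse_closed\<close> compose
    in exactly this form.\<close>
  have "(\<Sum>\<chi>\<in>?X. \<chi> a) = (\<Sum>\<chi>\<in>?X. (\<lambda>x\<in>carrier G. \<theta> x * \<chi> x) a)"
  proof (rule sum.reindex_bij_witness[where i = "\<lambda>\<chi>. \<lambda>x\<in>carrier G. \<theta> x * \<chi> x"
        and j = "\<lambda>\<chi>. \<lambda>x\<in>carrier G. (\<lambda>x\<in>carrier G. inverse (\<theta> x)) x * \<chi> x"])
    fix \<chi> assume \<chi>: "\<chi> \<in> ?X"
    then have ext: "\<chi> \<in> extensional (carrier G)" by (simp add: carrier_character_group)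
    show "(\<lambda>x\<in>carrier G. \<theta> x * \<chi> x) \<in> ?X" by (rule character_mult_closed[OF \<theta>(1) \<chi>])
    show "(\<lambda>x\<in>carrier G. (\<lambda>x\<in>carrier G. inverse (\<theta> x)) x * \<chi> x) \<in> ?X"
      by (rule character_mult_closed[OF character_inverse_closed[OF \<theta>(1)] \<chi>])
    show "(\<lambda>x\<in>carrier G. \<theta> x * (\<lambda>x\<in>carrier G. (\<lambda>x\<in>carrier G. inverse (\<theta> x)) x * \<chi> x) x) = \<chi>"
      "(\<lambda>x\<in>carrier G. (\<lambda>x\<in>carrier G. inverse (\<theta> x)) x * (\<lambda>x\<in>carrier G. \<theta> x * \<chi> x) x) = \<chi>"
      by (rule extensionalityI[OF _ ext]; use D(2) in force)+
    show "(\<lambda>x\<in>carrier G. \<theta> x * (\<lambda>x\<in>carrier G. (\<lambda>x\<in>carrier G. inverse (\<theta> x)) x * \<chi> x) x) a = \<chi> a"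
      using D(2)[OF a] a by simp
  qed
  also have "\<dots> = \<theta> a * (\<Sum>\<chi>\<in>?X. \<chi> a)"
    using a by (simp add: sum_distrib_left)
  finally show ?thesis using \<theta>(2) False by auto
qed

text \<open>Double counting of the sum of \<open>\<chi> a\<close> over all pairs: summed over
  characters first, only the neutral element contributes; summed over group elements first, only the
  trivial character does.\<close>

lemma (in comm_group) card_character_group:
  assumes fin: "finite (carrier G)"
  shows "card (carrier (character_group G)) = order G"
proof -
  let ?X = "carrier (character_group G)"
  let ?e = "\<lambda>x\<in>carrier G. 1 :: complex"
  have e: "?e \<in> ?X" by (auto simp: carrier_character_group hom_def)
  have triv: "(\<forall>x\<in>carrier G. \<chi> x = 1) \<longleftrightarrow> \<chi> = ?e" if "\<chi> \<in> ?X" for \<chi>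
    using that extensionalityI[of \<chi> "carrier G" ?e] by (auto simp: carrier_character_group)
  have "(of_nat (card ?X) :: complex) = (\<Sum>a\<in>carrier G. \<Sum>\<chi>\<in>?X. \<chi> a)"
    using fin by (simp add: sum_over_characters)
  also have "\<dots> = (\<Sum>\<chi>\<in>?X. \<Sum>a\<in>carrier G. \<chi> a)" by (rule sum.swap)
  also have "\<dots> = (\<Sum>\<chi>\<in>?X. if \<chi> = ?e then of_nat (order G) else 0)"
    by (intro sum.cong refl) (simp add: sum_character[OF fin] triv)
  also have "\<dots> = of_nat (order G)" using e finite_character_group[OF fin] by simp
  finally show ?thesis by (simp only: of_nat_eq_iff)
qed

lemma (in comm_group) character_orthogonality_columns:
  assumes "finite (carrier G)" "a \<in> carrier G" "b \<in> carrier G"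
  shows "(\<Sum>\<chi>\<in>carrier (character_group G). \<chi> a / \<chi> b) = (if a = b then of_nat (order G) else 0)"
proof -
  have "(\<Sum>\<chi>\<in>carrier (character_group G). \<chi> a / \<chi> b) =
      (\<Sum>\<chi>\<in>carrier (character_group G). \<chi> (a \<otimes> inv b))"
    using assms by (intro sum.cong refl) (simp add: characterD divide_inverse)
  moreover have "a \<otimes> inv b = \<one> \<longleftrightarrow> a = b"
    using assms by (metis inv_closed inv_inv inv_equality r_inv)
  ultimately show ?thesis
    using assms by (simp add: sum_over_characters card_character_group)
qed

text \<open>The quotient of \<chi> by \<psi> is again a character, and it is trivial exactly when
  the two agree.\<close>

lemma (in comm_group) character_orthogonality_rows:
  assumes "finite (carrier G)"
    and \<chi>: "\<chi> \<in> carrier (character_group G)" and \<psi>: "\<psi> \<in> carrier (character_group G)"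
  shows "(\<Sum>a\<in>carrier G. \<chi> a / \<psi> a) = (if \<chi> = \<psi> then of_nat (order G) else 0)"
proof -
  define \<rho> where "\<rho> = (\<lambda>x\<in>carrier G. \<chi> x * (\<lambda>x\<in>carrier G. inverse (\<psi> x)) x)"
  have \<rho>: "\<rho> \<in> carrier (character_group G)"
    unfolding \<rho>_def by (rule character_mult_closed[OF \<chi> character_inverse_closed[OF \<psi>]])
  have "(\<forall>x\<in>carrier G. \<rho> x = 1) \<longleftrightarrow> (\<forall>x\<in>carrier G. \<chi> x = \<psi> x)"
    using characterD(2)[OF \<psi>] by (auto simp: \<rho>_def field_simps)
  also have "\<dots> \<longleftrightarrow> \<chi> = \<psi>"
    using \<chi> \<psi> by (auto simp: carrier_character_group intro: extensionalityI)
  finally show ?thesis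
    using sum_character[OF assms(1) \<rho>] by (simp add: \<rho>_def divide_inverse)
qed

subsection \<open>Isomorphisms and products of algebras\<close>

lemma algebra_isoI:
  assumes "bij_betw h (carrier A) (carrier B)"
    and "\<And>x y. \<lbrakk>x \<in> carrier A; y \<in> carrier A\<rbrakk> \<Longrightarrow> h (x \<otimes>\<^bsub>A\<^esub> y) = h x \<otimes>\<^bsub>B\<^esub> h y"
    and "\<And>x y. \<lbrakk>x \<in> carrier A; y \<in> carrier A\<rbrakk> \<Longrightarrow> h (x \<oplus>\<^bsub>A\<^esub> y) = h x \<oplus>\<^bsub>B\<^esub> h y"
    and "h \<one>\<^bsub>A\<^esub> = \<one>\<^bsub>B\<^esub>"
    and "\<And>c x. x \<in> carrier A \<Longrightarrow> h (c \<odot>\<^bsub>A\<^esub> x) = c \<odot>\<^bsub>B\<^esub> h x"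
  shows "h \<in> algebra_iso A B"
  using assms by (auto simp: algebra_iso_def ring_iso_def ring_hom_def dest: bij_betwE)

lemma algebra_isoD:
  assumes "h \<in> algebra_iso A B"
  shows "bij_betw h (carrier A) (carrier B)"
    and "\<And>x. x \<in> carrier A \<Longrightarrow> h x \<in> carrier B"
    and "\<And>x y. \<lbrakk>x \<in> carrier A; y \<in> carrier A\<rbrakk> \<Longrightarrow> h (x \<otimes>\<^bsub>A\<^esub> y) = h x \<otimes>\<^bsub>B\<^esub> h y"
    and "\<And>x y. \<lbrakk>x \<in> carrier A; y \<in> carrier A\<rbrakk> \<Longrightarrow> h (x \<oplus>\<^bsub>A\<^esub> y) = h x \<oplus>\<^bsub>B\<^esub> h y"
    and "h \<one>\<^bsub>A\<^esub> = \<one>\<^bsub>B\<^esub>"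
    and "\<And>c x. x \<in> carrier A \<Longrightarrow> h (c \<odot>\<^bsub>A\<^esub> x) = c \<odot>\<^bsub>B\<^esub> h x"
  using assms by (auto simp: algebra_iso_def ring_iso_def ring_hom_def)

lemma algebra_iso_trans:
  assumes "algebra_iso A B \<noteq> {}" "algebra_iso B C \<noteq> {}"
  shows "algebra_iso A C \<noteq> {}"
proof -
  obtain f g where f: "f \<in> algebra_iso A B" and g: "g \<in> algebra_iso B C" using assms by blast
  have "g \<circ> f \<in> algebra_iso A C"
    by (rule algebra_isoI)
      (use algebra_isoD[OF f] algebra_isoD[OF g] in \<open>auto intro: bij_betw_trans\<close>)
  then show ?thesis by blast
qed

text \<open>The record type carries no axioms, so closure of \<open>A\<close> is assumed: it puts
  the result of an operation into the carrier, where \<open>eq\<close> recognises it as a preimage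
  by applying \<open>h\<close>.\<close>

lemma algebra_iso_sym:
  assumes "algebra_iso A B \<noteq> {}"
    and mult: "\<And>x y. \<lbrakk>x \<in> carrier A; y \<in> carrier A\<rbrakk> \<Longrightarrow> x \<otimes>\<^bsub>A\<^esub> y \<in> carrier A"
    and add: "\<And>x y. \<lbrakk>x \<in> carrier A; y \<in> carrier A\<rbrakk> \<Longrightarrow> x \<oplus>\<^bsub>A\<^esub> y \<in> carrier A"
    and one: "\<one>\<^bsub>A\<^esub> \<in> carrier A"
    and smult: "\<And>c x. x \<in> carrier A \<Longrightarrow> c \<odot>\<^bsub>A\<^esub> x \<in> carrier A"
  shows "algebra_iso B A \<noteq> {}"
proof -
  obtain h where h: "h \<in> algebra_iso A B" using assms(1) by blast
  note D = algebra_isoD[OF h]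
  let ?k = "inv_into (carrier A) h"
  have k: "bij_betw ?k (carrier B) (carrier A)" by (rule bij_betw_inv_into[OF D(1)])
  have kA: "?k u \<in> carrier A" if "u \<in> carrier B" for u using k that by (auto dest: bij_betwE)
  have hk: "h (?k u) = u" if "u \<in> carrier B" for u
    using D(1) that by (simp add: bij_betw_inv_into_right)
  have eq: "?k u = x" if "x \<in> carrier A" "h x = u" for u x
    using D(1) that by (metis bij_betw_inv_into_left)
  have "?k \<in> algebra_iso B A"
    by (rule algebra_isoI[OF k]; rule eq) (auto simp: D kA hk mult add one smult)
  then show ?thesis by blast
qed

definition product_algebra ::
  "'i set \<Rightarrow> ('i \<Rightarrow> (complex, 'c) module) \<Rightarrow> (complex, 'i \<Rightarrow> 'c) module" where
  "product_algebra I A =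
     \<lparr>carrier = \<Pi>\<^sub>E i\<in>I. carrier (A i),
      monoid.mult = (\<lambda>x y. \<lambda>i\<in>I. x i \<otimes>\<^bsub>A i\<^esub> y i),
      one = (\<lambda>i\<in>I. \<one>\<^bsub>A i\<^esub>),
      ring.zero = (\<lambda>i\<in>I. \<zero>\<^bsub>A i\<^esub>),
      add = (\<lambda>x y. \<lambda>i\<in>I. x i \<oplus>\<^bsub>A i\<^esub> y i),
      smult = (\<lambda>c x. \<lambda>i\<in>I. c \<odot>\<^bsub>A i\<^esub> x i)\<rparr>"

lemma product_algebra_iso:
  assumes b: "bij_betw \<pi> I J"
    and iso: "\<And>i. i \<in> I \<Longrightarrow> algebra_iso (A i) (B (\<pi> i)) \<noteq> {}"
  shows "algebra_iso (product_algebra I A) (product_algebra J B) \<noteq> {}"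
proof -
  define \<rho> where "\<rho> = inv_into I \<pi>"
  have \<rho>: "\<And>j. j \<in> J \<Longrightarrow> \<rho> j \<in> I" "\<And>j. j \<in> J \<Longrightarrow> \<pi> (\<rho> j) = j" "\<And>i. i \<in> I \<Longrightarrow> \<rho> (\<pi> i) = i"
    and \<pi>: "\<And>i. i \<in> I \<Longrightarrow> \<pi> i \<in> J"
    using b bij_betwE[OF bij_betw_inv_into[OF b]] bij_betwE[OF b]
    by (auto simp: \<rho>_def bij_betw_inv_into_right bij_betw_inv_into_left)
  obtain h where h: "\<And>i. i \<in> I \<Longrightarrow> h i \<in> algebra_iso (A i) (B (\<pi> i))"
    using iso by (simp add: ex_in_conv[symmetric]) metis
  \<comment> \<open>Reindexes the chosen isomorphisms by the target factors, so that the algebra at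
    \<open>j\<close> appears without the detour through \<pi>.\<close>
  have h': "h (\<rho> j) \<in> algebra_iso (A (\<rho> j)) (B j)" if "j \<in> J" for j
    using h[OF \<rho>(1)[OF that]] \<rho>(2)[OF that] by simp
  note D = algebra_isoD[OF h']
  define k where "k i = inv_into (carrier (A i)) (h i)" for i
  have k: "k i y \<in> carrier (A i)" "h i (k i y) = y" if "i \<in> I" "y \<in> carrier (B (\<pi> i))" for i y
    using algebra_isoD(1)[OF h[OF that(1)]] that(2) bij_betwE[OF bij_betw_inv_into]
    by (auto simp: k_def bij_betw_inv_into_right)
  have kh: "k i (h i x) = x" if "i \<in> I" "x \<in> carrier (A i)" for i x
    using algebra_isoD(1)[OF h[OF that(1)]] that(2) by (auto simp: k_def bij_betw_inv_into_left)
  let ?H = "\<lambda>x. \<lambda>j\<in>J. h (\<rho> j) (x (\<rho> j))"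
  have "?H \<in> algebra_iso (product_algebra I A) (product_algebra J B)"
  proof (rule algebra_isoI)
    show "bij_betw ?H (carrier (product_algebra I A)) (carrier (product_algebra J B))"
    proof (rule bij_betw_byWitness[where f' = "\<lambda>y. \<lambda>i\<in>I. k i (y (\<pi> i))"])
      show "\<forall>x\<in>carrier (product_algebra I A). (\<lambda>i\<in>I. k i (?H x (\<pi> i))) = x"
        by (auto simp: product_algebra_def \<rho> \<pi> kh PiE_iff intro!: extensionalityI[of _ I])
      show "\<forall>y\<in>carrier (product_algebra J B). ?H (\<lambda>i\<in>I. k i (y (\<pi> i))) = y"
        by (auto simp: product_algebra_def \<rho> \<pi> k PiE_iff intro!: extensionalityI[of _ J])
      show "?H ` carrier (product_algebra I A) \<subseteq> carrier (product_algebra J B)"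
        by (fastforce simp: product_algebra_def \<rho>(1) PiE_iff intro: D(2))
      show "(\<lambda>y. \<lambda>i\<in>I. k i (y (\<pi> i))) ` carrier (product_algebra J B) \<subseteq> carrier (product_algebra I A)"
        by (auto simp: product_algebra_def \<pi> PiE_iff intro!: k(1))
    qed
  qed (auto simp: product_algebra_def D \<rho>(1) PiE_iff intro!: restrict_ext)
  then show ?thesis by blast
qed

lemma twisted_group_algebra_simps:
  "carrier (twisted_group_algebra G \<alpha>) = carrier G \<rightarrow>\<^sub>E UNIV"
  "f \<otimes>\<^bsub>twisted_group_algebra G \<alpha>\<^esub> g = (\<lambda>x\<in>carrier G.
     \<Sum>(y, z) \<in> {(y, z) \<in> carrier G \<times> carrier G. y \<otimes>\<^bsub>G\<^esub> z = x}. f y * g z * \<alpha> (y, z))"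
  "\<one>\<^bsub>twisted_group_algebra G \<alpha>\<^esub> =
     (\<lambda>x\<in>carrier G. if x = \<one>\<^bsub>G\<^esub> then inverse (\<alpha> (\<one>\<^bsub>G\<^esub>, \<one>\<^bsub>G\<^esub>)) else 0)"
  "f \<oplus>\<^bsub>twisted_group_algebra G \<alpha>\<^esub> g = (\<lambda>x\<in>carrier G. f x + g x)"
  "c \<odot>\<^bsub>twisted_group_algebra G \<alpha>\<^esub> f = (\<lambda>x\<in>carrier G. c * f x)"
  by (simp_all add: twisted_group_algebra_def)

lemma twisted_group_algebra_iso_sym:
  assumes "algebra_iso (twisted_group_algebra G \<alpha>) B \<noteq> {}"
  shows "algebra_iso B (twisted_group_algebra G \<alpha>) \<noteq> {}"
  by (rule algebra_iso_sym[OF assms]) (auto simp: twisted_group_algebra_simps)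

subsection \<open>Cohomologous cocycles\<close>

text \<open>A relation between arbitrary functions, compared only on the carrier, so that
  representatives can be compared without verifying the cocycle identity for them.\<close>

definition cohomologous ::
  "('a, 'm) monoid_scheme \<Rightarrow> ('a \<times> 'a \<Rightarrow> complex) \<Rightarrow> ('a \<times> 'a \<Rightarrow> complex) \<Rightarrow> bool" where
  "cohomologous G \<alpha> \<beta> \<longleftrightarrow> (\<exists>f. (\<forall>x\<in>carrier G. f x \<noteq> 0) \<and>
     (\<forall>x\<in>carrier G. \<forall>y\<in>carrier G. \<beta> (x, y) = f x * f y / f (x \<otimes>\<^bsub>G\<^esub> y) * \<alpha> (x, y)))"

lemma cohomologous_refl: "cohomologous G \<alpha> \<alpha>"
  unfolding cohomologous_def by (rule exI[of _ "\<lambda>_. 1"]) simp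

lemma (in monoid) cohomologous_sym:
  assumes "cohomologous G \<alpha> \<beta>"
  shows "cohomologous G \<beta> \<alpha>"
proof -
  from assms obtain f where "\<forall>x\<in>carrier G. f x \<noteq> 0"
    "\<forall>x\<in>carrier G. \<forall>y\<in>carrier G. \<beta> (x, y) = f x * f y / f (x \<otimes> y) * \<alpha> (x, y)"
    by (auto simp: cohomologous_def)
  then show ?thesis
    unfolding cohomologous_def by (intro exI[of _ "\<lambda>x. inverse (f x)"]) (simp add: field_simps)
qed

lemma (in monoid) cohomologous_trans:
  assumes "cohomologous G \<alpha> \<beta>" "cohomologous G \<beta> \<gamma>"
  shows "cohomologous G \<alpha> \<gamma>"
proof -
  from assms obtain f g where "\<forall>x\<in>carrier G. f x \<noteq> 0" "\<forall>x\<in>carrier G. g x \<noteq> 0"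
    "\<forall>x\<in>carrier G. \<forall>y\<in>carrier G. \<beta> (x, y) = f x * f y / f (x \<otimes> y) * \<alpha> (x, y)"
    "\<forall>x\<in>carrier G. \<forall>y\<in>carrier G. \<gamma> (x, y) = g x * g y / g (x \<otimes> y) * \<beta> (x, y)"
    by (auto simp: cohomologous_def)
  then show ?thesis
    unfolding cohomologous_def by (intro exI[of _ "\<lambda>x. f x * g x"]) (simp add: mult_ac)
qed

section \<open>Cohomology classes as sets of functions\<close>

lemma mult_cocycles2:
  "\<alpha> \<otimes>\<^bsub>cocycles2 G\<^esub> \<beta> = (\<lambda>p\<in>carrier G \<times> carrier G. \<alpha> p * \<beta> p)"
  by (simp add: cocycles2_def cochains2_def product_group_def)

text \<open>Turns cosets into a pointwise condition. Extensionality is what upgrades agreement on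
  pairs from the carrier to equality of functions.\<close>

lemma cohomology_class_eq:
  "cohomology_class G \<alpha> = {\<beta> \<in> extensional (carrier G \<times> carrier G). cohomologous G \<alpha> \<beta>}"
proof (intro Set.equalityI subsetI)
  fix \<beta> assume "\<beta> \<in> cohomology_class G \<alpha>"
  then obtain f where "f \<in> carrier G \<rightarrow> - {0}" "\<beta> = coboundary2 G f \<otimes>\<^bsub>cocycles2 G\<^esub> \<alpha>"
    by (auto simp: cohomology_class_def r_coset_def coboundaries2_def)
  then show "\<beta> \<in> {\<beta> \<in> extensional (carrier G \<times> carrier G). cohomologous G \<alpha> \<beta>}"
    by (auto simp: cohomologous_def mult_cocycles2 coboundary2_def Pi_def intro!: exI[of _ f])
next
  fix \<beta> assume "\<beta> \<in> {\<beta> \<in> extensional (carrier G \<times> carrier G). cohomologous G \<alpha> \<beta>}"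
  then obtain f where ext: "\<beta> \<in> extensional (carrier G \<times> carrier G)" and f: "f \<in> carrier G \<rightarrow> - {0}"
    "\<And>x y. \<lbrakk>x \<in> carrier G; y \<in> carrier G\<rbrakk> \<Longrightarrow> \<beta> (x, y) = f x * f y / f (x \<otimes>\<^bsub>G\<^esub> y) * \<alpha> (x, y)"
    by (auto simp: cohomologous_def)
  have "\<beta> = coboundary2 G f \<otimes>\<^bsub>cocycles2 G\<^esub> \<alpha>"
    by (rule extensionalityI[OF ext]) (auto simp: mult_cocycles2 coboundary2_def f)
  then show "\<beta> \<in> cohomology_class G \<alpha>"
    using f(1) by (auto simp: cohomology_class_def r_coset_def coboundaries2_def)
qed

lemma (in monoid) cohomology_class_cong:
  assumes "cohomologous G \<alpha> \<beta>"
  shows "cohomology_class G \<alpha> = cohomology_class G \<beta>"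
  unfolding cohomology_class_eq
  using cohomologous_trans[OF assms] cohomologous_trans[OF cohomologous_sym[OF assms]] by blast

lemma carrier_H2: "carrier (H2 G) = cohomology_class G ` carrier (cocycles2 G)"
  by (auto simp: H2_def FactGroup_def RCOSETS_def cohomology_class_def)

lemma mult_H2: "c \<otimes>\<^bsub>H2 G\<^esub> d = c <#>\<^bsub>cocycles2 G\<^esub> d"
  by (simp add: H2_def FactGroup_def)

lemma H2_nonempty:
  assumes "c \<in> carrier (H2 G)"
  shows "c \<noteq> {}"
proof -
  obtain \<alpha> where "\<alpha> \<in> carrier (cocycles2 G)" "c = cohomology_class G \<alpha>"
    using assms by (auto simp: carrier_H2)
  then have "\<alpha> \<in> c"
    by (auto simp: cohomology_class_eq cohomologous_refl cocycles2_def cochains2_def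
        product_group_def PiE_def)
  then show ?thesis by blast
qed

lemma (in monoid) H2_cohomologous:
  assumes "c \<in> carrier (H2 G)" "\<alpha> \<in> c" "\<beta> \<in> c"
  shows "cohomologous G \<alpha> \<beta>"
proof -
  obtain \<gamma> where "c = cohomology_class G \<gamma>"
    using assms(1) by (auto simp: carrier_H2)
  then have "cohomologous G \<gamma> \<alpha>" "cohomologous G \<gamma> \<beta>"
    using assms by (auto simp: cohomology_class_eq)
  then show ?thesis by (blast intro: cohomologous_sym cohomologous_trans)
qed

text \<open>Rescaling the basis: dividing the basis element at x by \<open>f x\<close> absorbs the
  coboundary of \<open>f\<close>.\<close>

lemma (in monoid) cohomologous_imp_algebra_iso:
  assumes "cohomologous G \<alpha> \<beta>"
  shows "algebra_iso (twisted_group_algebra G \<alpha>) (twisted_group_algebra G \<beta>) \<noteq> {}"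
proof -
  obtain f where f: "\<And>x. x \<in> carrier G \<Longrightarrow> f x \<noteq> 0"
    and \<beta>: "\<And>x y. \<lbrakk>x \<in> carrier G; y \<in> carrier G\<rbrakk> \<Longrightarrow>
      \<beta> (x, y) = f x * f y / f (x \<otimes> y) * \<alpha> (x, y)"
    using assms by (auto simp: cohomologous_def)
  let ?h = "\<lambda>u. \<lambda>x\<in>carrier G. u x / f x"
  have "?h \<in> algebra_iso (twisted_group_algebra G \<alpha>) (twisted_group_algebra G \<beta>)"
  proof (rule algebra_isoI)
    show "bij_betw ?h (carrier (twisted_group_algebra G \<alpha>)) (carrier (twisted_group_algebra G \<beta>))"
      by (rule bij_betw_byWitness[where f' = "\<lambda>u. \<lambda>x\<in>carrier G. u x * f x"])
        (auto simp: twisted_group_algebra_simps f PiE_iff intro!: extensionalityI[of _ "carrier G"])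
    show "?h (u \<otimes>\<^bsub>twisted_group_algebra G \<alpha>\<^esub> v) = ?h u \<otimes>\<^bsub>twisted_group_algebra G \<beta>\<^esub> ?h v" for u v
      unfolding twisted_group_algebra_simps
      by (intro restrict_ext, simp add: sum_divide_distrib, intro sum.cong)
        (auto simp: \<beta> f)
  qed (auto simp: twisted_group_algebra_simps \<beta> f add_divide_distrib divide_inverse mult_ac distrib_left intro!: restrict_ext)
  then show ?thesis by blast
qed

section \<open>Representatives of inflated and transgressed classes\<close>

text \<open>Evaluates \<open>the_elem\<close> at any chosen representative. The image is a singleton
  because a cochain \<open>f\<close> on the quotient relating two representatives pulls back to
  \<open>f (H #> x)\<close>, which relates their inflations.\<close>

lemma (in normal) inflation_eq:
  assumes "d \<in> carrier (H2 (G Mod H))" "\<alpha> \<in> d"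
  shows "inflation G H d = cohomology_class G (inflate_cocycle G H \<alpha>)"
proof -
  interpret Q: group "G Mod H" by (rule factorgroup_is_group)
  have "cohomologous G (inflate_cocycle G H \<alpha>) (inflate_cocycle G H \<beta>)"
    if "cohomologous (G Mod H) \<alpha> \<beta>" for \<beta>
  proof -
    from that obtain f where "\<forall>U\<in>rcosets H. f U \<noteq> 0"
      "\<forall>U\<in>rcosets H. \<forall>V\<in>rcosets H. \<beta> (U, V) = f U * f V / f (U <#> V) * \<alpha> (U, V)"
      by (auto simp: cohomologous_def FactGroup_def)
    then show ?thesis
      unfolding cohomologous_def
      by (intro exI[of _ "\<lambda>x. f (H #> x)"])
        (auto simp: inflate_cocycle_def rcos_sum rcosetsI[OF subset])
  qed
  then have "(\<lambda>\<beta>. cohomology_class G (inflate_cocycle G H \<beta>)) ` d =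
      {cohomology_class G (inflate_cocycle G H \<alpha>)}"
    using assms(2) Q.H2_cohomologous[OF assms] cohomology_class_cong[symmetric]
    by (intro Set.equalityI image_subsetI) auto
  then show ?thesis by (simp add: inflation_def)
qed

text \<open>The representative from which \<open>transgression\<close> forms its class; twisting an
  algebra requires a function and not a class.\<close>

definition transgression_cocycle ::
  "('a, 'm) monoid_scheme \<Rightarrow> 'a set \<Rightarrow> ('a set \<Rightarrow> 'a)
     \<Rightarrow> ('a \<Rightarrow> complex) \<Rightarrow> 'a set \<times> 'a set \<Rightarrow> complex" where
  "transgression_cocycle G Z \<sigma> \<chi> =
     (\<lambda>(U, V)\<in>carrier (G Mod Z) \<times> carrier (G Mod Z).
        \<chi> (\<sigma> U \<otimes>\<^bsub>G\<^esub> \<sigma> V \<otimes>\<^bsub>G\<^esub> inv\<^bsub>G\<^esub> (\<sigma> (U \<otimes>\<^bsub>G Mod Z\<^esub> V))))"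

lemma transgression_cocycle_in_transgression:
  "transgression_cocycle G Z \<sigma> \<chi> \<in> transgression G Z \<sigma> \<chi>"
  by (simp add: transgression_def transgression_cocycle_def cohomology_class_eq cohomologous_refl)

subsection \<open>Decomposition of inflated twisted group algebras\<close>

locale finite_central_extension = group G for G (structure) +
  fixes Z :: "'a set" and \<sigma> :: "'a set \<Rightarrow> 'a"
  assumes finite_carrier: "finite (carrier G)"
    and central: "central_subgroup Z G"
    and coset_section: "coset_section G Z \<sigma>"
begin

abbreviation A where "A \<equiv> G\<lparr>carrier := Z\<rparr>"

lemma subgroup_Z: "subgroup Z G"
  and Z_commute: "\<lbrakk>z \<in> Z; g \<in> carrier G\<rbrakk> \<Longrightarrow> z \<otimes> g = g \<otimes> z"
  using central by (auto simp: central_subgroup_def)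

sublocale subgroup Z G by (rule subgroup_Z)

sublocale normal Z G
  by (rule normalI[OF subgroup_Z]) (auto simp: r_coset_def l_coset_def Z_commute)

sublocale Q: group "G Mod Z" by (rule factorgroup_is_group)

sublocale A: comm_group A
proof -
  interpret A: group A by (rule subgroup_imp_group[OF subgroup_Z])
  show "comm_group A" by (rule A.group_comm_groupI) (auto intro: Z_commute)
qed

declare mult_FactGroup [simp del] one_FactGroup [simp del]

lemma carrier_Mod: "carrier (G Mod Z) = (\<lambda>x. Z #> x) ` carrier G"
  by (auto simp: FactGroup_def RCOSETS_def)

lemma mult_Mod:
  "\<lbrakk>x \<in> carrier G; y \<in> carrier G\<rbrakk> \<Longrightarrow> (Z #> x) \<otimes>\<^bsub>G Mod Z\<^esub> (Z #> y) = Z #> (x \<otimes> y)"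
  by (simp add: FactGroup_def rcos_sum)

lemma finite_Mod: "finite (carrier (G Mod Z))"
  using finite_carrier by (simp add: carrier_Mod)

lemma one_Mod: "\<one>\<^bsub>G Mod Z\<^esub> = Z #> \<one>"
  by (simp add: FactGroup_def subset)

lemma coset_eq_iff:
  assumes "x \<in> carrier G" "y \<in> carrier G"
  shows "Z #> x = Z #> y \<longleftrightarrow> x \<otimes> inv y \<in> Z"
proof
  assume "Z #> x = Z #> y"
  then have "x \<in> Z #> y" using rcos_self[OF assms(1) subgroup_Z] by simp
  then obtain z where "z \<in> Z" "x = z \<otimes> y" by (auto simp: r_coset_def)
  then show "x \<otimes> inv y \<in> Z" using assms by (simp add: m_assoc)
next
  assume "x \<otimes> inv y \<in> Z"
  moreover have "x = (x \<otimes> inv y) \<otimes> y" using assms by (simp add: m_assoc)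
  ultimately have "x \<in> Z #> y" by (auto simp: r_coset_def)
  then show "Z #> x = Z #> y" using repr_independence[OF _ assms(2) subgroup_Z] by simp
qed

lemma section_closed: "U \<in> carrier (G Mod Z) \<Longrightarrow> \<sigma> U \<in> carrier G"
  and coset_section_eq: "U \<in> carrier (G Mod Z) \<Longrightarrow> Z #> \<sigma> U = U"
proof -
  assume U: "U \<in> carrier (G Mod Z)"
  then obtain x where x: "x \<in> carrier G" "U = Z #> x" by (auto simp: carrier_Mod)
  have "\<sigma> U \<in> Z #> x" using coset_section U x(2) by (auto simp: coset_section_def)
  then show "\<sigma> U \<in> carrier G" "Z #> \<sigma> U = U"
    using r_coset_subset_G[OF subset x(1)] repr_independence[OF _ x(1) subgroup_Z] x(2) by auto
qed

section \<open>Coordinates with respect to the section\<close>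

definition central_part :: "'a \<Rightarrow> 'a" where
  "central_part x = x \<otimes> inv (\<sigma> (Z #> x))"

text \<open>The factor set of the extension belonging to \<sigma>; composing it with \<chi> gives
  \<open>transgression_cocycle\<close>.\<close>

definition factor_set :: "'a set \<Rightarrow> 'a set \<Rightarrow> 'a" where
  "factor_set U V = \<sigma> U \<otimes> \<sigma> V \<otimes> inv (\<sigma> (U \<otimes>\<^bsub>G Mod Z\<^esub> V))"

lemma coset_in_Mod: "x \<in> carrier G \<Longrightarrow> Z #> x \<in> carrier (G Mod Z)"
  by (simp add: carrier_Mod)

lemma central_part_closed: "x \<in> carrier G \<Longrightarrow> central_part x \<in> Z"
  unfolding central_part_def
  by (subst coset_eq_iff[symmetric]) (simp_all add: coset_in_Mod section_closed coset_section_eq)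

lemma central_part_section: "x \<in> carrier G \<Longrightarrow> central_part x \<otimes> \<sigma> (Z #> x) = x"
  by (simp add: central_part_def coset_in_Mod section_closed m_assoc)

lemma factor_set_closed:
  assumes "U \<in> carrier (G Mod Z)" "V \<in> carrier (G Mod Z)"
  shows "factor_set U V \<in> Z"
  unfolding factor_set_def
  by (subst coset_eq_iff[symmetric])
    (simp_all add: assms section_closed coset_section_eq mult_Mod[symmetric])

text \<open>The defect of multiplicativity of \<open>central_part\<close> is the factor set, since
  the central part of y can be moved past the section value of x. This defect is the source of the
  transgression twist in the component at \<chi>.\<close>

lemma central_part_mult:
  assumes x: "x \<in> carrier G" and y: "y \<in> carrier G"
  shows "central_part (x \<otimes> y) = central_part x \<otimes> central_part y \<otimes> factor_set (Z #> x) (Z #> y)"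
proof -
  let ?u = "\<sigma> (Z #> x)" and ?v = "\<sigma> (Z #> y)"
  have uv: "?u \<in> carrier G" "?v \<in> carrier G" "\<sigma> (Z #> (x \<otimes> y)) \<in> carrier G"
    using x y by (simp_all add: coset_in_Mod section_closed)
  have c: "central_part x \<in> carrier G" "central_part y \<in> carrier G"
    using x y central_part_closed by auto
  have "x \<otimes> y = (central_part x \<otimes> ?u) \<otimes> (central_part y \<otimes> ?v)"
    using x y by (simp add: central_part_section)
  also have "\<dots> = central_part x \<otimes> ((?u \<otimes> central_part y) \<otimes> ?v)"
    using c uv by (simp add: m_assoc)
  also have "\<dots> = central_part x \<otimes> ((central_part y \<otimes> ?u) \<otimes> ?v)"
    using Z_commute[OF central_part_closed[OF y] uv(1)] by simp
  also have "\<dots> = central_part x \<otimes> central_part y \<otimes> (?u \<otimes> ?v)"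
    using c uv by (simp add: m_assoc)
  finally have eq: "x \<otimes> y = central_part x \<otimes> central_part y \<otimes> (?u \<otimes> ?v)" .
  have "central_part (x \<otimes> y) = x \<otimes> y \<otimes> inv (\<sigma> (Z #> (x \<otimes> y)))"
    by (rule central_part_def)
  also have "\<dots> = central_part x \<otimes> central_part y \<otimes> (?u \<otimes> ?v) \<otimes> inv (\<sigma> (Z #> (x \<otimes> y)))"
    by (rule arg_cong[OF eq, where f = "\<lambda>u. u \<otimes> inv (\<sigma> (Z #> (x \<otimes> y)))"])
  finally show ?thesis
    using x y uv c by (simp add: factor_set_def mult_Mod m_assoc)
qed

text \<open>Identifies each coset with Z, so that sums over a fibre become sums over Z and the
  orthogonality relations apply.\<close>

lemma central_part_bij:
  assumes "W \<in> carrier (G Mod Z)"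
  shows "bij_betw central_part {x \<in> carrier G. Z #> x = W} Z"
proof (rule bij_betw_byWitness[where f' = "\<lambda>z. z \<otimes> \<sigma> W"])
  have *: "Z #> (z \<otimes> \<sigma> W) = W" if "z \<in> Z" for z
  proof -
    have "Z #> (z \<otimes> \<sigma> W) = Z #> \<sigma> W"
      using that assms by (subst coset_eq_iff) (simp_all add: section_closed m_assoc)
    then show ?thesis using assms by (simp add: coset_section_eq)
  qed
  show "\<forall>x\<in>{x \<in> carrier G. Z #> x = W}. central_part x \<otimes> \<sigma> W = x"
    using central_part_section by auto
  show "\<forall>z\<in>Z. central_part (z \<otimes> \<sigma> W) = z"
    using assms * by (simp add: central_part_def section_closed m_assoc)
  show "central_part ` {x \<in> carrier G. Z #> x = W} \<subseteq> Z"
    using central_part_closed by auto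
  show "(\<lambda>z. z \<otimes> \<sigma> W) ` Z \<subseteq> {x \<in> carrier G. Z #> x = W}"
    using assms * by (auto simp: section_closed)
qed

section \<open>Fourier transform along the cosets\<close>

abbreviation X where "X \<equiv> carrier (character_group A)"

lemma character_mult: "\<lbrakk>\<chi> \<in> X; z \<in> Z; w \<in> Z\<rbrakk> \<Longrightarrow> \<chi> (z \<otimes> w) = \<chi> z * \<chi> w"
  and character_neq_0: "\<lbrakk>\<chi> \<in> X; z \<in> Z\<rbrakk> \<Longrightarrow> \<chi> z \<noteq> 0"
  using A.characterD[of \<chi>] by simp_all

lemma finite_Z: "finite Z"
  using finite_carrier subset by (rule finite_subset[rotated])

lemma orthogonality_rows:
  "\<lbrakk>\<chi> \<in> X; \<psi> \<in> X\<rbrakk> \<Longrightarrow> (\<Sum>z\<in>Z. \<chi> z / \<psi> z) = (if \<chi> = \<psi> then of_nat (card Z) else 0)"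
  using A.character_orthogonality_rows[of \<chi> \<psi>] finite_Z by (simp add: order_def)

lemma orthogonality_columns:
  "\<lbrakk>z \<in> Z; w \<in> Z\<rbrakk> \<Longrightarrow> (\<Sum>\<chi>\<in>X. \<chi> z / \<chi> w) = (if z = w then of_nat (card Z) else 0)"
  using A.character_orthogonality_columns[of z w] finite_Z by (simp add: order_def)

lemma finite_X: "finite X"
  using A.finite_character_group finite_Z by simp

lemma card_Z_neq_0: "(of_nat (card Z) :: complex) \<noteq> 0"
  using finite_Z subgroup.one_closed[OF subgroup_Z] by (metis card_eq_0_iff empty_iff of_nat_eq_0_iff)

text \<open>The Fourier transform on every coset of Z, each identified with Z by
  \<open>central_part\<close>.\<close>

definition fiber_transform :: "('a \<Rightarrow> complex) \<Rightarrow> ('a \<Rightarrow> complex) \<Rightarrow> 'a set \<Rightarrow> complex" where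
  "fiber_transform f = (\<lambda>\<chi>\<in>X. \<lambda>W\<in>carrier (G Mod Z).
     \<Sum>x | x \<in> carrier G \<and> Z #> x = W. f x * \<chi> (central_part x))"

definition inverse_fiber_transform :: "(('a \<Rightarrow> complex) \<Rightarrow> 'a set \<Rightarrow> complex) \<Rightarrow> 'a \<Rightarrow> complex" where
  "inverse_fiber_transform F = (\<lambda>x\<in>carrier G.
     (\<Sum>\<chi>\<in>X. F \<chi> (Z #> x) / \<chi> (central_part x)) / of_nat (card Z))"

text \<open>Column orthogonality leaves only those y in the coset of x that have the same central
  part; by injectivity on the fibre this is x alone.\<close>

lemma inverse_fiber_transform_fiber_transform:
  assumes "f \<in> extensional (carrier G)"
  shows "inverse_fiber_transform (fiber_transform f) = f"
proof (rule extensionalityI[OF _ assms])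
  fix x assume x: "x \<in> carrier G"
  let ?S = "{y \<in> carrier G. Z #> y = Z #> x}"
  have "(\<Sum>\<chi>\<in>X. fiber_transform f \<chi> (Z #> x) / \<chi> (central_part x)) =
      (\<Sum>\<chi>\<in>X. \<Sum>y\<in>?S. f y * (\<chi> (central_part y) / \<chi> (central_part x)))"
    by (intro sum.cong refl) (simp add: fiber_transform_def x coset_in_Mod sum_divide_distrib)
  also have "\<dots> = (\<Sum>y\<in>?S. f y * (\<Sum>\<chi>\<in>X. \<chi> (central_part y) / \<chi> (central_part x)))"
    by (subst sum.swap) (simp add: sum_distrib_left)
  also have "\<dots> = (\<Sum>y\<in>?S. if y = x then of_nat (card Z) * f x else 0)"
  proof (intro sum.cong refl)
    fix y assume y: "y \<in> ?S"
    have "central_part y = central_part x \<longleftrightarrow> y = x"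
      using bij_betw_imp_inj_on[OF central_part_bij[OF coset_in_Mod[OF x]]] x y
      by (auto simp: inj_on_def)
    then show "f y * (\<Sum>\<chi>\<in>X. \<chi> (central_part y) / \<chi> (central_part x)) =
        (if y = x then of_nat (card Z) * f x else 0)"
      using x y by (simp add: orthogonality_columns central_part_closed)
  qed
  also have "\<dots> = of_nat (card Z) * f x"
    using x finite_carrier by simp
  finally show "inverse_fiber_transform (fiber_transform f) x = f x"
    using x card_Z_neq_0 by (simp add: inverse_fiber_transform_def)
qed (simp add: inverse_fiber_transform_def)

text \<open>After the fibre is reindexed by Z, row orthogonality isolates the component at
  \<chi>.\<close>

lemma fiber_transform_inverse_fiber_transform:
  assumes F: "F \<in> X \<rightarrow>\<^sub>E (carrier (G Mod Z) \<rightarrow>\<^sub>E UNIV)"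
  shows "fiber_transform (inverse_fiber_transform F) = F"
proof (rule extensionalityI)
  fix \<chi> assume \<chi>: "\<chi> \<in> X"
  show "fiber_transform (inverse_fiber_transform F) \<chi> = F \<chi>"
  proof (rule extensionalityI)
    show "F \<chi> \<in> extensional (carrier (G Mod Z))" using F \<chi> by (auto simp: PiE_iff)
    fix W assume W: "W \<in> carrier (G Mod Z)"
    let ?S = "{x \<in> carrier G. Z #> x = W}"
    have "fiber_transform (inverse_fiber_transform F) \<chi> W =
        (\<Sum>x\<in>?S. (\<Sum>\<psi>\<in>X. F \<psi> W * (\<chi> (central_part x) / \<psi> (central_part x)) / of_nat (card Z)))"
      using \<chi> W by (auto simp: fiber_transform_def inverse_fiber_transform_def sum_distrib_right
          sum_divide_distrib intro!: sum.cong)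
    also have "\<dots> = (\<Sum>z\<in>Z. (\<Sum>\<psi>\<in>X. F \<psi> W * (\<chi> z / \<psi> z) / of_nat (card Z)))"
      by (rule sum.reindex_bij_betw[OF central_part_bij[OF W]])
    also have "\<dots> = (\<Sum>\<psi>\<in>X. F \<psi> W * (\<Sum>z\<in>Z. \<chi> z / \<psi> z) / of_nat (card Z))"
      by (subst sum.swap) (simp add: sum_distrib_left sum_divide_distrib)
    also have "\<dots> = (\<Sum>\<psi>\<in>X. if \<psi> = \<chi> then F \<chi> W else 0)"
      using \<chi> card_Z_neq_0 by (intro sum.cong refl) (auto simp: orthogonality_rows)
    also have "\<dots> = F \<chi> W" using finite_X \<chi> by simp
    finally show "fiber_transform (inverse_fiber_transform F) \<chi> W = F \<chi> W" .
  qed (use \<chi> in \<open>simp add: fiber_transform_def\<close>)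
qed (use F in \<open>auto simp: fiber_transform_def PiE_iff\<close>)

text \<open>Both sides at W sum the same term \<open>?t\<close> over all pairs (x, y) whose product
  lies in W. The left side groups the pairs by the product x y, the right side by the pair of their
  cosets; \<open>central_part_mult\<close> matches the scalars.\<close>

lemma fiber_transform_mult:
  assumes \<chi>: "\<chi> \<in> X"
  shows "fiber_transform (f \<otimes>\<^bsub>twisted_group_algebra G (inflate_cocycle G Z \<alpha>)\<^esub> g) \<chi> =
    fiber_transform f \<chi>
      \<otimes>\<^bsub>twisted_group_algebra (G Mod Z) (\<alpha> \<otimes>\<^bsub>cocycles2 (G Mod Z)\<^esub> transgression_cocycle G Z \<sigma> \<chi>)\<^esub>
    fiber_transform g \<chi>"
    (is "?L = ?R")
proof (rule extensionalityI)
  let ?M = "carrier (G Mod Z)"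
  fix W assume W: "W \<in> ?M"
  let ?t = "\<lambda>x y. f x * g y * \<alpha> (Z #> x, Z #> y) * \<chi> (central_part (x \<otimes> y))"
  let ?P = "{p \<in> carrier G \<times> carrier G. Z #> (fst p \<otimes> snd p) = W}"
  have finP: "finite ?P" using finite_carrier by simp
  have "?L W = (\<Sum>x | x \<in> carrier G \<and> Z #> x = W.
      \<Sum>p | p \<in> ?P \<and> fst p \<otimes> snd p = x. ?t (fst p) (snd p))"
    using \<chi> W
    by (auto simp: fiber_transform_def twisted_group_algebra_simps sum_distrib_right
        inflate_cocycle_def intro!: sum.cong)
  also have "\<dots> = (\<Sum>p\<in>?P. ?t (fst p) (snd p))"
    by (rule sum.group[OF finP]) (use finite_carrier in auto)
  finally have L: "?L W = (\<Sum>p\<in>?P. ?t (fst p) (snd p))" .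
  let ?D = "{q \<in> ?M \<times> ?M. fst q \<otimes>\<^bsub>G Mod Z\<^esub> snd q = W}"
  have "?R W = (\<Sum>q\<in>?D. (\<Sum>x | x \<in> carrier G \<and> Z #> x = fst q. f x * \<chi> (central_part x)) *
      (\<Sum>y | y \<in> carrier G \<and> Z #> y = snd q. g y * \<chi> (central_part y)) *
      (\<alpha> q * \<chi> (factor_set (fst q) (snd q))))"
    using \<chi> W
    by (auto simp: fiber_transform_def twisted_group_algebra_simps mult_cocycles2
        transgression_cocycle_def factor_set_def intro!: sum.cong)
  also have "\<dots> = (\<Sum>q\<in>?D. \<Sum>p | p \<in> ?P \<and> (Z #> fst p, Z #> snd p) = q. ?t (fst p) (snd p))"
  proof (intro sum.cong refl)
    fix q assume q: "q \<in> ?D"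
    \<comment> \<open>For q in \<open>?D\<close> the condition on the coset of the product is
      automatic. The fibre over q is therefore a full product of two cosets, over which the product
      of the two sums expands.\<close>
    have fibers: "{p \<in> ?P. (Z #> fst p, Z #> snd p) = q} =
        {x \<in> carrier G. Z #> x = fst q} \<times> {y \<in> carrier G. Z #> y = snd q}"
      using q by (auto simp: mult_Mod)
    have "\<chi> (central_part (x \<otimes> y)) =
        \<chi> (central_part x) * \<chi> (central_part y) * \<chi> (factor_set (fst q) (snd q))"
      if "x \<in> carrier G" "Z #> x = fst q" "y \<in> carrier G" "Z #> y = snd q" for x y
      using that q \<chi> central_part_mult[of x y]
      by (auto simp: character_mult central_part_closed factor_set_closed)
    then show "(\<Sum>x | x \<in> carrier G \<and> Z #> x = fst q. f x * \<chi> (central_part x)) *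
      (\<Sum>y | y \<in> carrier G \<and> Z #> y = snd q. g y * \<chi> (central_part y)) *
      (\<alpha> q * \<chi> (factor_set (fst q) (snd q))) =
      (\<Sum>p | p \<in> ?P \<and> (Z #> fst p, Z #> snd p) = q. ?t (fst p) (snd p))"
      unfolding fibers by (subst sum_product) (auto simp: sum.cartesian_product sum_distrib_right intro!: sum.cong)
  qed
  also have "\<dots> = (\<Sum>p\<in>?P. ?t (fst p) (snd p))"
    by (rule sum.group[OF finP]) (use finite_Mod in \<open>auto simp: coset_in_Mod mult_Mod\<close>)
  finally show "?L W = ?R W" using L by simp
qed (use \<chi> in \<open>auto simp: fiber_transform_def twisted_group_algebra_simps\<close>)

text \<open>As \<sigma> need not be normalised, the central part of the neutral element may be
  non-trivial. Its value under \<chi> is the inverse of \<chi> at the factor set of the trivial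
  coset with itself, by \<open>central_part_mult\<close> at the neutral element, and this is the
  correction in the unit of the twisted algebra.\<close>

lemma fiber_transform_one:
  assumes \<chi>: "\<chi> \<in> X"
  shows "fiber_transform \<one>\<^bsub>twisted_group_algebra G (inflate_cocycle G Z \<alpha>)\<^esub> \<chi> =
    \<one>\<^bsub>twisted_group_algebra (G Mod Z) (\<alpha> \<otimes>\<^bsub>cocycles2 (G Mod Z)\<^esub> transgression_cocycle G Z \<sigma> \<chi>)\<^esub>"
    (is "?L = ?R")
proof (rule extensionalityI)
  let ?o = "\<one>\<^bsub>G Mod Z\<^esub>"
  fix W assume W: "W \<in> carrier (G Mod Z)"
  have "\<chi> (central_part \<one>) = \<chi> (central_part \<one>) * \<chi> (central_part \<one>) * \<chi> (factor_set ?o ?o)"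
    using \<chi> arg_cong[OF central_part_mult[of \<one> \<one>], of \<chi>]
    by (simp add: character_mult central_part_closed factor_set_closed flip: one_Mod)
  then have inv: "\<chi> (central_part \<one>) = inverse (\<chi> (factor_set ?o ?o))"
    using character_neq_0[OF \<chi> central_part_closed[of \<one>]]
    by (intro inverse_unique[symmetric]) (simp add: mult_ac)
  have "?L W = (\<Sum>x | x \<in> carrier G \<and> Z #> x = W.
      if x = \<one> then inverse (\<alpha> (?o, ?o)) * \<chi> (central_part \<one>) else 0)"
    using \<chi> W by (auto simp: fiber_transform_def twisted_group_algebra_simps inflate_cocycle_def
        one_Mod intro!: sum.cong)
  also have "\<dots> = (if W = ?o then inverse (\<alpha> (?o, ?o)) * \<chi> (central_part \<one>) else 0)"
    using finite_carrier by (auto simp: one_Mod)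
  also have "\<dots> = ?R W"
    using W inv by (simp add: twisted_group_algebra_simps mult_cocycles2 transgression_cocycle_def
        factor_set_def)
  finally show "?L W = ?R W" .
qed (use \<chi> in \<open>auto simp: fiber_transform_def twisted_group_algebra_simps\<close>)

text \<open>The twist at \<chi> is given as an explicit product of functions, so that it can be
  recognised later as an element of a product of two classes.\<close>

lemma inflated_algebra_decomposition:
  "fiber_transform \<in> algebra_iso (twisted_group_algebra G (inflate_cocycle G Z \<alpha>))
     (product_algebra X (\<lambda>\<chi>. twisted_group_algebra (G Mod Z)
       (\<alpha> \<otimes>\<^bsub>cocycles2 (G Mod Z)\<^esub> transgression_cocycle G Z \<sigma> \<chi>)))"
    (is "_ \<in> algebra_iso ?B ?P")
proof (rule algebra_isoI)
  show "bij_betw fiber_transform (carrier ?B) (carrier ?P)"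
  proof (rule bij_betw_byWitness[where f' = inverse_fiber_transform])
    show "\<forall>f\<in>carrier ?B. inverse_fiber_transform (fiber_transform f) = f"
      by (auto simp: twisted_group_algebra_simps PiE_iff inverse_fiber_transform_fiber_transform)
    show "\<forall>F\<in>carrier ?P. fiber_transform (inverse_fiber_transform F) = F"
      by (auto simp: twisted_group_algebra_simps product_algebra_def
          fiber_transform_inverse_fiber_transform)
    show "fiber_transform ` carrier ?B \<subseteq> carrier ?P"
      by (auto simp: fiber_transform_def twisted_group_algebra_simps product_algebra_def)
    show "inverse_fiber_transform ` carrier ?P \<subseteq> carrier ?B"
      by (auto simp: inverse_fiber_transform_def twisted_group_algebra_simps)
  qed
  have ext: "fiber_transform f \<in> extensional X" for f by (simp add: fiber_transform_def)
  show "fiber_transform (f \<otimes>\<^bsub>?B\<^esub> g) = fiber_transform f \<otimes>\<^bsub>?P\<^esub> fiber_transform g" for f g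
    by (rule extensionalityI[OF ext]) (auto simp: product_algebra_def fiber_transform_mult)
  show "fiber_transform \<one>\<^bsub>?B\<^esub> = \<one>\<^bsub>?P\<^esub>"
    by (rule extensionalityI[OF ext]) (auto simp: product_algebra_def fiber_transform_one)
  show "fiber_transform (f \<oplus>\<^bsub>?B\<^esub> g) = fiber_transform f \<oplus>\<^bsub>?P\<^esub> fiber_transform g" for f g
    by (rule extensionalityI[OF ext])
      (auto simp: product_algebra_def fiber_transform_def twisted_group_algebra_simps
        distrib_right sum.distrib intro!: restrict_ext)
  show "fiber_transform (c \<odot>\<^bsub>?B\<^esub> f) = c \<odot>\<^bsub>?P\<^esub> fiber_transform f" for c f
    by (rule extensionalityI[OF ext])
      (auto simp: product_algebra_def fiber_transform_def twisted_group_algebra_simps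
        sum_distrib_left mult_ac intro!: restrict_ext)
qed

end

subsection \<open>Descent to the second cohomology groups\<close>

text \<open>B and B' are the quotients of A and A' by kernels that \<phi> matches. The induced map
  sends b to \<open>q (\<phi> a)\<close> for any preimage a of b.\<close>

lemma epi_induced_iso:
  assumes A: "group A" and B: "group B" and A': "group A'" and B': "group B'"
    and p: "p \<in> epi A B" and q: "q \<in> epi A' B'" and \<phi>: "\<phi> \<in> iso A A'"
    and ker: "\<phi> ` kernel A B p = kernel A' B' q"
  shows "\<exists>\<psi>\<in>iso B B'. \<forall>a\<in>carrier A. \<psi> (p a) = q (\<phi> a)"
proof -
  have ph: "p \<in> hom A B" and psurj: "p ` carrier A = carrier B"
    and qh: "q \<in> hom A' B'" and qsurj: "q ` carrier A' = carrier B'"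
    and \<phi>h: "\<phi> \<in> hom A A'" and \<phi>b: "bij_betw \<phi> (carrier A) (carrier A')"
    using p q \<phi> by (auto simp: epi_def iso_def)
  interpret p: group_hom A B p using A B ph by (simp add: group_hom_def group_hom_axioms_def)
  interpret q: group_hom A' B' q using A' B' qh by (simp add: group_hom_def group_hom_axioms_def)
  interpret f: group_hom A A' \<phi> using A A' \<phi>h by (simp add: group_hom_def group_hom_axioms_def)
  have ker_iff: "p x = \<one>\<^bsub>B\<^esub> \<longleftrightarrow> q (\<phi> x) = \<one>\<^bsub>B'\<^esub>" if x: "x \<in> carrier A" for x
  proof -
    have "p x = \<one>\<^bsub>B\<^esub> \<longleftrightarrow> \<phi> x \<in> \<phi> ` kernel A B p"
      using x \<phi>b by (auto simp: kernel_def bij_betw_def inj_on_def)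
    also have "\<dots> \<longleftrightarrow> q (\<phi> x) = \<one>\<^bsub>B'\<^esub>" using x by (simp add: ker) (simp add: kernel_def)
    finally show ?thesis .
  qed
  \<comment> \<open>The kernel criterion for the quotient of the two elements. From left to right it
    makes \<psi> independent of the preimage, from right to left injective.\<close>
  have eq_iff: "p a = p a' \<longleftrightarrow> q (\<phi> a) = q (\<phi> a')"
    if "a \<in> carrier A" "a' \<in> carrier A" for a a'
  proof -
    have "p a = p a' \<longleftrightarrow> p (a \<otimes>\<^bsub>A\<^esub> inv\<^bsub>A\<^esub> a') = \<one>\<^bsub>B\<^esub>"
      using that by (simp add: p.H.inv_solve_right')
    also have "\<dots> \<longleftrightarrow> q (\<phi> (a \<otimes>\<^bsub>A\<^esub> inv\<^bsub>A\<^esub> a')) = \<one>\<^bsub>B'\<^esub>"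
      using that by (intro ker_iff) simp
    also have "\<dots> \<longleftrightarrow> q (\<phi> a) = q (\<phi> a')"
      using that by (simp add: q.H.inv_solve_right')
    finally show ?thesis .
  qed
  define s where "s = inv_into (carrier A) p"
  have s: "s b \<in> carrier A" "p (s b) = b" if "b \<in> carrier B" for b
    using that psurj by (auto simp: s_def f_inv_into_f inv_into_into)
  define \<psi> where "\<psi> b = q (\<phi> (s b))" for b
  have \<psi>p: "\<psi> (p a) = q (\<phi> a)" if "a \<in> carrier A" for a
    unfolding \<psi>_def using that s[of "p a"] by (subst eq_iff[symmetric]) auto
  have "\<psi> (b \<otimes>\<^bsub>B\<^esub> b') = \<psi> b \<otimes>\<^bsub>B'\<^esub> \<psi> b'" if "b \<in> carrier B" "b' \<in> carrier B" for b b'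
    using \<psi>p[of "s b \<otimes>\<^bsub>A\<^esub> s b'"] s that by (simp add: \<psi>_def)
  moreover have "inj_on \<psi> (carrier B)"
    using s eq_iff unfolding \<psi>_def inj_on_def by metis
  moreover have "\<psi> ` carrier B = carrier B'"
    unfolding psurj[symmetric] qsurj[symmetric] bij_betw_imp_surj_on[OF \<phi>b, symmetric] image_image
    by (intro image_cong refl \<psi>p)
  ultimately have "\<psi> \<in> iso B B'"
    by (auto simp: iso_def hom_def bij_betw_def)
  with \<psi>p show ?thesis by blast
qed

section \<open>Comparison of the two decompositions\<close>

theorem theorem1p2:
  fixes G1 :: "('a, 'm) monoid_scheme" and G2 :: "('b, 'n) monoid_scheme"
  assumes "group G1" and "finite (carrier G1)"
    and "group G2" and "finite (carrier G2)"
    and "central_subgroup Z1 G1" and "central_subgroup Z2 G2"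
    and "coset_section G1 Z1 \<sigma>1" and "coset_section G2 Z2 \<sigma>2"
    and "short_exact (character_group (G1\<lparr>carrier := Z1\<rparr>)) (H2 (G1 Mod Z1)) (H2 G1)
           (transgression G1 Z1 \<sigma>1) (inflation G1 Z1)"
    and "short_exact (character_group (G2\<lparr>carrier := Z2\<rparr>)) (H2 (G2 Mod Z2)) (H2 G2)
           (transgression G2 Z2 \<sigma>2) (inflation G2 Z2)"
    and "i \<in> iso (character_group (G1\<lparr>carrier := Z1\<rparr>)) (character_group (G2\<lparr>carrier := Z2\<rparr>))"
    and "\<phi> \<in> iso (H2 (G1 Mod Z1)) (H2 (G2 Mod Z2))"
    and "twisted_equiv_via \<phi> (G1 Mod Z1) (G2 Mod Z2)"
    and "\<And>\<chi>. \<chi> \<in> carrier (character_group (G1\<lparr>carrier := Z1\<rparr>)) \<Longrightarrow>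
           \<phi> (transgression G1 Z1 \<sigma>1 \<chi>) = transgression G2 Z2 \<sigma>2 (i \<chi>)"
  shows "twisted_equiv G1 G2"
proof -
  interpret E1: finite_central_extension G1 Z1 \<sigma>1
    by (simp add: finite_central_extension_def finite_central_extension_axioms_def assms)
  interpret E2: finite_central_extension G2 Z2 \<sigma>2
    by (simp add: finite_central_extension_def finite_central_extension_axioms_def assms)
  let ?Q1 = "G1 Mod Z1" and ?Q2 = "G2 Mod Z2"
  let ?tra1 = "transgression G1 Z1 \<sigma>1" and ?tra2 = "transgression G2 Z2 \<sigma>2"
  have groups: "group (H2 ?Q1)" "group (H2 G1)" "group (H2 ?Q2)" "group (H2 G2)"
    and tra: "?tra1 \<in> mon (character_group E1.A) (H2 ?Q1)"
    and inf: "inflation G1 Z1 \<in> epi (H2 ?Q1) (H2 G1)" "inflation G2 Z2 \<in> epi (H2 ?Q2) (H2 G2)"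
    and ker: "kernel (H2 ?Q1) (H2 G1) (inflation G1 Z1) = ?tra1 ` E1.X"
      "kernel (H2 ?Q2) (H2 G2) (inflation G2 Z2) = ?tra2 ` E2.X"
    using assms(9,10) by (auto simp: short_exact_def)
  have i: "bij_betw i E1.X E2.X" using assms(11) by (simp add: iso_def)
  \<comment> \<open>By exactness the kernels of the inflations are the images of the transgressions;
    the commuting square and surjectivity of \<open>i\<close> carry one onto the other.\<close>
  have "\<phi> ` ?tra1 ` E1.X = ?tra2 ` i ` E1.X"
    using assms(14) by (auto simp: image_image intro!: image_cong)
  also have "i ` E1.X = E2.X" using i by (simp add: bij_betw_def)
  finally have "\<phi> ` kernel (H2 ?Q1) (H2 G1) (inflation G1 Z1) =
      kernel (H2 ?Q2) (H2 G2) (inflation G2 Z2)" by (simp add: ker)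
  then obtain \<psi> where \<psi>: "\<psi> \<in> iso (H2 G1) (H2 G2)"
    and \<psi>_inf: "\<And>d. d \<in> carrier (H2 ?Q1) \<Longrightarrow> \<psi> (inflation G1 Z1 d) = inflation G2 Z2 (\<phi> d)"
    using epi_induced_iso[OF groups inf assms(12)] by blast
  have "algebra_iso (twisted_group_algebra G1 \<alpha>) (twisted_group_algebra G2 \<beta>) \<noteq> {}"
    if c: "c \<in> carrier (H2 G1)" and \<alpha>: "\<alpha> \<in> c" and \<beta>: "\<beta> \<in> \<psi> c" for c \<alpha> \<beta>
  proof -
    obtain d where d: "d \<in> carrier (H2 ?Q1)" "c = inflation G1 Z1 d"
      using inf(1) c by (auto simp: epi_def)
    have \<phi>h: "\<phi> \<in> hom (H2 ?Q1) (H2 ?Q2)" using assms(12) by (simp add: iso_def)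
    then have \<phi>d: "\<phi> d \<in> carrier (H2 ?Q2)" using d(1) by (rule hom_in_carrier)
    obtain \<alpha>' \<beta>' where \<alpha>': "\<alpha>' \<in> d" and \<beta>': "\<beta>' \<in> \<phi> d"
      using H2_nonempty[OF d(1)] H2_nonempty[OF \<phi>d] by blast
    let ?I1 = "inflate_cocycle G1 Z1 \<alpha>'" and ?I2 = "inflate_cocycle G2 Z2 \<beta>'"
    let ?T1 = "\<lambda>\<chi>. twisted_group_algebra ?Q1
      (\<alpha>' \<otimes>\<^bsub>cocycles2 ?Q1\<^esub> transgression_cocycle G1 Z1 \<sigma>1 \<chi>)"
    let ?T2 = "\<lambda>\<chi>. twisted_group_algebra ?Q2
      (\<beta>' \<otimes>\<^bsub>cocycles2 ?Q2\<^esub> transgression_cocycle G2 Z2 \<sigma>2 \<chi>)"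
    \<comment> \<open>The given representatives of c and \<open>\<psi> c\<close> need not be
      inflated functions; they are only cohomologous to the inflations of \<alpha>' and \<beta>',
      which suffices up to algebra isomorphism.\<close>
    have "cohomologous G1 ?I1 \<alpha>" "cohomologous G2 ?I2 \<beta>"
      using \<alpha> \<beta> d \<psi>_inf[OF d(1)] E1.inflation_eq[OF d(1) \<alpha>'] E2.inflation_eq[OF \<phi>d \<beta>']
      by (auto simp: cohomology_class_eq)
    then have ends: "algebra_iso (twisted_group_algebra G1 \<alpha>) (twisted_group_algebra G1 ?I1) \<noteq> {}"
      "algebra_iso (twisted_group_algebra G2 ?I2) (twisted_group_algebra G2 \<beta>) \<noteq> {}"
      using E1.cohomologous_imp_algebra_iso E2.cohomologous_imp_algebra_iso E1.cohomologous_sym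
      by blast+
    have middle: "algebra_iso (product_algebra E1.X ?T1) (product_algebra E2.X ?T2) \<noteq> {}"
    proof (rule product_algebra_iso[OF i])
      fix \<chi> assume \<chi>: "\<chi> \<in> E1.X"
      have t: "?tra1 \<chi> \<in> carrier (H2 ?Q1)"
        using tra \<chi> unfolding mon_def by (blast dest: hom_in_carrier)
      have dt: "d \<otimes>\<^bsub>H2 ?Q1\<^esub> ?tra1 \<chi> \<in> carrier (H2 ?Q1)"
        using group.is_monoid[OF groups(1)] d(1) t by (rule monoid.m_closed)
      \<comment> \<open>The homomorphism property and the commuting square pair the factor at \<chi>
        with the factor at \<open>i \<chi>\<close>.\<close>
      have "\<phi> (d \<otimes>\<^bsub>H2 ?Q1\<^esub> ?tra1 \<chi>) = \<phi> d \<otimes>\<^bsub>H2 ?Q2\<^esub> ?tra2 (i \<chi>)"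
        using hom_mult[OF \<phi>h d(1) t] assms(14)[OF \<chi>] by simp
      \<comment> \<open>Multiplication in H2 is the product of sets, so a product of representatives
        lies in the product class.\<close>
      moreover have "\<alpha>' \<otimes>\<^bsub>cocycles2 ?Q1\<^esub> transgression_cocycle G1 Z1 \<sigma>1 \<chi> \<in> d \<otimes>\<^bsub>H2 ?Q1\<^esub> ?tra1 \<chi>"
        using \<alpha>' transgression_cocycle_in_transgression unfolding mult_H2 set_mult_def by blast
      moreover have "\<beta>' \<otimes>\<^bsub>cocycles2 ?Q2\<^esub> transgression_cocycle G2 Z2 \<sigma>2 (i \<chi>)
          \<in> \<phi> d \<otimes>\<^bsub>H2 ?Q2\<^esub> ?tra2 (i \<chi>)"
        using \<beta>' transgression_cocycle_in_transgression unfolding mult_H2 set_mult_def by blast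
      ultimately show "algebra_iso (?T1 \<chi>) (?T2 (i \<chi>)) \<noteq> {}"
        using assms(13) dt unfolding twisted_equiv_via_def by metis
    qed
    have decomp: "algebra_iso (twisted_group_algebra G1 ?I1) (product_algebra E1.X ?T1) \<noteq> {}"
      "algebra_iso (twisted_group_algebra G2 ?I2) (product_algebra E2.X ?T2) \<noteq> {}"
      using E1.inflated_algebra_decomposition E2.inflated_algebra_decomposition by blast+
    show ?thesis
      by (rule algebra_iso_trans[OF ends(1) algebra_iso_trans[OF decomp(1)
            algebra_iso_trans[OF middle algebra_iso_trans[OF
              twisted_group_algebra_iso_sym[OF decomp(2)] ends(2)]]]])
  qed
  with \<psi> show ?thesis unfolding twisted_equiv_def twisted_equiv_via_def by blast
qed

end
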